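(* Let $n\ge 1$ and write $f_n(q)=\sum_{w\in\widetilde S_n^{FC}}q^{\ell(w)}=\sum_{i\ge 0}a_iq^i$. Then the coefficients $a_i$ are periodic for sufficiently large $i$, with a period $m$ dividing $n$; i.e. there exist a divisor $m$ of $n$ and an $i_0$ such that $a_{i+m}=a_i$ for all $i\ge i_0$. When $n=p$ is prime, the period is $m=1$, and in this case there are precisely $$\frac{1}{p}\Bigg(\binom{2p}{p}-2\Bigg)$$ fully commutative elements of length $i$ in $\widetilde S_p$ for all sufficiently large $i$.
   Context: For $n\ge 1$, the affine symmetric group $\widetilde S_n$ is the group of bijections $w:\mathbb{Z}\to\mathbb{Z}$ with $w(i+n)=w(i)+n$ for all $i$ and $\sum_{i=1}^n w(i)=\binom{n+1}{2}$, under composition. For $n\ge 2$ it is a Coxeter group with generators $s_0,s_1,\dots,s_{n-1}$, where $s_i$ interchanges $i+kn$ and $i+1+kn$ for every $k\in\mathbb{Z}$ and fixes all other integers; $\widetilde S_1$ is trivial (no generators). The Coxeter length $\ell(w)$ is the minimal number of generators in an expression for $w$; expressions attaining it are reduced. An element $w$ is fully commutative if any reduced expression for $w$ can be obtained from any other using only interchanges of adjacent commuting generators. $\widetilde S_n^{FC}$ denotes the set of fully commutative elements of $\widetilde S_n$. *)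

theory Defs
  imports "HOL-Computational_Algebra.Computational_Algebra"
begin

definition affine_sym :: "nat \<Rightarrow> (int \<Rightarrow> int) set" where
  "affine_sym n = {w. bij w \<and> (\<forall>i. w (i + int n) = w i + int n) \<and>
      (\<Sum>i = 1..int n. w i) = int ((n + 1) choose 2)}"

text \<open>Indices of the simple generators; for \<open>n = 1\<close> the group is trivial and has none.\<close>

definition gen_index :: "nat \<Rightarrow> nat set" where
  "gen_index n = (if n \<ge> 2 then {..<n} else {})"

definition simple_gen :: "nat \<Rightarrow> nat \<Rightarrow> int \<Rightarrow> int" where
  "simple_gen n i x =
     (if \<exists>k. x = int i + k * int n then x + 1
      else if \<exists>k. x = int i + 1 + k * int n then x - 1
      else x)"

text \<open>Since \<open>i \<mapsto> s\<^sub>i\<close> is injective on \<^term>\<open>gen_index n\<close>, words in the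
  generators are represented by lists of indices.\<close>

definition word_prod :: "nat \<Rightarrow> nat list \<Rightarrow> int \<Rightarrow> int" where
  "word_prod n us = foldr (\<circ>) (map (simple_gen n) us) id"

definition expressions :: "nat \<Rightarrow> (int \<Rightarrow> int) \<Rightarrow> nat list set" where
  "expressions n w = {us. set us \<subseteq> gen_index n \<and> word_prod n us = w}"

definition cox_length :: "nat \<Rightarrow> (int \<Rightarrow> int) \<Rightarrow> nat" where
  "cox_length n w = (LEAST l. \<exists>us \<in> expressions n w. length us = l)"

definition reduced_expressions :: "nat \<Rightarrow> (int \<Rightarrow> int) \<Rightarrow> nat list set" where
  "reduced_expressions n w = {us \<in> expressions n w. length us = cox_length n w}"

definition commutation_step :: "nat \<Rightarrow> (nat list \<times> nat list) set" where
  "commutation_step n = {(us @ [i, j] @ vs, us @ [j, i] @ vs) | us i j vs.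
      simple_gen n i \<circ> simple_gen n j = simple_gen n j \<circ> simple_gen n i}"

definition fully_commutative :: "nat \<Rightarrow> (int \<Rightarrow> int) set" where
  "fully_commutative n = {w \<in> affine_sym n.
      \<forall>us \<in> reduced_expressions n w. \<forall>vs \<in> reduced_expressions n w.
        (us, vs) \<in> (commutation_step n)\<^sup>*}"

definition fc_of_length :: "nat \<Rightarrow> nat \<Rightarrow> (int \<Rightarrow> int) set" where
  "fc_of_length n i = {w \<in> fully_commutative n. cox_length n w = i}"

text \<open>The series \<open>\<Sum> q ^ cox_length n w\<close> over the fully commutative \<open>w\<close>, with equal powers
  of \<open>q\<close> collected; every coefficient is the cardinality of a finite set, see
  \<open>finite_fc_of_length\<close> below.\<close>

definition fc_series :: "nat \<Rightarrow> nat fps" where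
  "fc_series n = Abs_fps (\<lambda>i. card (fc_of_length n i))"

lemma simple_gen_altdef:
  assumes "n \<ge> 2"
  shows "simple_gen n i x = (if x mod int n = int i mod int n then x + 1
     else if x mod int n = (int i + 1) mod int n then x - 1 else x)"
proof -
  have "(\<exists>k. x = y + k * int n) \<longleftrightarrow> x mod int n = y mod int n" for y
    by (auto simp: mod_eq_dvd_iff dvd_def algebra_simps)
  thus ?thesis unfolding simple_gen_def by simp
qed

lemma simple_gen_shift: "simple_gen n i (x + int n) = simple_gen n i x + int n"
proof -
  have *: "(\<exists>k. x + int n = y + k * int n) \<longleftrightarrow> (\<exists>k. x = y + k * int n)" for y
  proof
    assume "\<exists>k. x + int n = y + k * int n"
    then obtain k where "x + int n = y + k * int n" by blast
    hence "x = y + (k - 1) * int n" by (simp add: algebra_simps)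
    thus "\<exists>k. x = y + k * int n" by blast
  next
    assume "\<exists>k. x = y + k * int n"
    then obtain k where "x = y + k * int n" by blast
    hence "x + int n = y + (k + 1) * int n" by (simp add: algebra_simps)
    thus "\<exists>k. x + int n = y + k * int n" by blast
  qed
  show ?thesis unfolding simple_gen_def * by simp
qed

lemma simple_gen_involution:
  assumes "n \<ge> 2" shows "simple_gen n i (simple_gen n i x) = x"
proof -
  let ?n = "int n"
  have n: "?n \<ge> 2" using assms by simp
  have ne: "y mod ?n \<noteq> (y + 1) mod ?n" for y
  proof
    assume "y mod ?n = (y + 1) mod ?n"
    hence "?n dvd 1" by (auto simp: mod_eq_dvd_iff)
    thus False using n by auto
  qed
  have a: "(x + 1) mod ?n = (y + 1) mod ?n \<longleftrightarrow> x mod ?n = y mod ?n" for x y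
    by (simp add: mod_eq_dvd_iff)
  have b: "(x - 1) mod ?n = y mod ?n \<longleftrightarrow> x mod ?n = (y + 1) mod ?n" for x y
    by (simp add: mod_eq_dvd_iff algebra_simps)
  show ?thesis
    using ne[of x] ne[of "int i"] a[of x "int i"] b[of x "int i"] assms
    by (auto simp: simple_gen_altdef)
qed

lemma affine_sym_iff:
  "w \<in> affine_sym n \<longleftrightarrow> bij w \<and> (\<forall>i. w (i + int n) = w i + int n) \<and>
     (\<Sum>i = 1..int n. w i - i) = 0"
proof -
  have "(\<Sum>i = 1..int n. i) = int ((n + 1) choose 2)"
  proof (induction n)
    case (Suc n)
    have "{1..int (Suc n)} = insert (int (Suc n)) {1..int n}" by auto
    with Suc show ?case by (simp add: numeral_2_eq_2)
  qed (simp add: numeral_2_eq_2)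
  thus ?thesis by (simp add: affine_sym_def sum_subtractf)
qed

lemma sum_periodic_window:
  fixes f :: "int \<Rightarrow> int"
  assumes "\<And>x. f (x + int n) = f x"
  shows "(\<Sum>x = a..<a + int n. f x) = (\<Sum>x = 1..int n. f x)"
proof -
  have step: "(\<Sum>x = a + 1..<a + 1 + int n. f x) = (\<Sum>x = a..<a + int n. f x)" for a
  proof (cases "n = 0")
    case False
    have "{a..<a + int n} = insert a {a + 1..<a + int n}"
         "{a + 1..<a + 1 + int n} = insert (a + int n) {a + 1..<a + int n}"
      using False by auto
    thus ?thesis using assms by simp
  qed auto
  have "(\<Sum>x = a..<a + int n. f x) = (\<Sum>x = 1..<1 + int n. f x)"
  proof (induction a rule: int_induct[where k = 1])
    case (step1 i)
    thus ?case using step[of i] by simp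
  next
    case (step2 i)
    thus ?case using step[of "i - 1"] by simp
  qed simp
  moreover have "{1..<1 + int n} = {1..int n}" by auto
  ultimately show ?thesis by simp
qed

lemma simple_gen_window:
  assumes "n \<ge> 2" "int i \<le> x" "x < int i + int n"
  shows "simple_gen n i x = (if x = int i then x + 1 else if x = int i + 1 then x - 1 else x)"
proof -
  have *: "x mod int n = y mod int n \<longleftrightarrow> x = y"
    if "int i \<le> y" "y < int i + int n" for y
  proof
    assume "x mod int n = y mod int n"
    hence "int n dvd x - y" by (simp add: mod_eq_dvd_iff)
    moreover have "\<bar>x - y\<bar> < int n" using that assms by auto
    ultimately show "x = y" using zdvd_not_zless[of "\<bar>x - y\<bar>" "int n"] by auto
  qed auto
  show ?thesis using *[of "int i"] *[of "int i + 1"] assms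
    by (simp add: simple_gen_altdef)
qed

lemma sum_comp_simple_gen:
  fixes F :: "int \<Rightarrow> int \<Rightarrow> int"
  assumes "n \<ge> 2" "\<And>y x. F (y + int n) (x + int n) = F y x"
    and "\<And>x. w (x + int n) = w x + int n"
  shows "(\<Sum>x = 1..int n. F (w (simple_gen n i x)) x) =
    (\<Sum>x = 1..int n. F (w x) x)
      + F (w (int i + 1)) (int i) + F (w (int i)) (int i + 1)
      - F (w (int i)) (int i) - F (w (int i + 1)) (int i + 1)"
proof -
  let ?W = "{int i..<int i + int n}" and ?R = "{int i + 2..<int i + int n}"
  have W: "?W = insert (int i) (insert (int i + 1) ?R)" using assms(1) by auto
  have "(\<Sum>x = 1..int n. F (w (simple_gen n i x)) x) = (\<Sum>x\<in>?W. F (w (simple_gen n i x)) x)"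
    by (rule sum_periodic_window[symmetric]) (simp add: assms simple_gen_shift)
  also have "\<dots> = (\<Sum>x\<in>?W. F (w (if x = int i then x + 1 else if x = int i + 1 then x - 1 else x)) x)"
    by (intro sum.cong refl) (use assms(1) in \<open>simp add: simple_gen_window\<close>)
  also have "\<dots> = F (w (int i + 1)) (int i) + F (w (int i)) (int i + 1) +
      (\<Sum>x\<in>?R. F (w (if x = int i then x + 1 else if x = int i + 1 then x - 1 else x)) x)"
    unfolding W by simp
  also have "(\<Sum>x\<in>?R. F (w (if x = int i then x + 1 else if x = int i + 1 then x - 1 else x)) x)
      = (\<Sum>x\<in>?R. F (w x) x)"
    by (intro sum.cong refl) auto
  also have "(\<Sum>x\<in>?R. F (w x) x) =
      (\<Sum>x\<in>?W. F (w x) x) - F (w (int i)) (int i) - F (w (int i + 1)) (int i + 1)"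
    unfolding W by simp
  also have "(\<Sum>x\<in>?W. F (w x) x) = (\<Sum>x = 1..int n. F (w x) x)"
    by (rule sum_periodic_window) (simp add: assms)
  finally show ?thesis by simp
qed

lemma affine_sym_comp_simple_gen:
  assumes "n \<ge> 2" "w \<in> affine_sym n"
  shows "w \<circ> simple_gen n i \<in> affine_sym n"
proof -
  have w: "bij w" "\<And>x. w (x + int n) = w x + int n" "(\<Sum>i = 1..int n. w i - i) = 0"
    using assms(2) by (auto simp: affine_sym_iff)
  have "bij (simple_gen n i)"
    by (rule o_bij[of "simple_gen n i"]) (auto simp: fun_eq_iff simple_gen_involution[OF assms(1)])
  thus ?thesis
    using w sum_comp_simple_gen[of n "(-)" w i, OF assms(1)]
    by (auto simp: affine_sym_iff simple_gen_shift bij_comp)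
qed

lemma affine_sym_descent:
  assumes "n \<ge> 1" "w \<in> affine_sym n" "w \<noteq> id"
  obtains i where "i < n" "w (int i) > w (int i + 1)"
proof -
  have w: "bij w" "\<And>x. w (x + int n) = w x + int n" "(\<Sum>i = 1..int n. w i - i) = 0"
    using assms(2) by (auto simp: affine_sym_iff)
  have "\<exists>i<n. w (int i) > w (int i + 1)"
  proof (rule ccontr)
    assume *: "\<not> ?thesis"
    have shift: "w (x + int k * int n) = w x + int k * int n" for x k
    proof (induction k)
      case (Suc k)
      thus ?case using w(2)[of "x + int k * int n"] by (simp add: algebra_simps)
    qed simp
    have shift': "w (x + k * int n) = w x + k * int n" for x k
    proof (cases "k \<ge> 0")
      case True
      thus ?thesis using shift[of x "nat k"] by simp
    next
      case False
      thus ?thesis using shift[of "x + k * int n" "nat (- k)"] by simp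
    qed
    have up: "w x < w (x + 1)" for x
    proof -
      have x: "x = x mod int n + (x div int n) * int n" by simp
      have "nat (x mod int n) < n" using assms(1) by (simp add: nat_less_iff)
      hence "\<not> w (int (nat (x mod int n))) > w (int (nat (x mod int n)) + 1)"
        using * by blast
      hence "w (x mod int n) \<le> w (x mod int n + 1)"
        using assms(1) by simp
      moreover have "w x = w (x mod int n) + (x div int n) * int n"
        using shift'[of "x mod int n" "x div int n"] by simp
      moreover have "w (x + 1) = w (x mod int n + 1) + (x div int n) * int n"
      proof -
        have "x + 1 = x mod int n + 1 + (x div int n) * int n" using x by linarith
        thus ?thesis using shift'[of "x mod int n + 1" "x div int n"] by simp
      qed
      ultimately have "w x \<le> w (x + 1)" by simp
      moreover have "w x \<noteq> w (x + 1)" using inj_eq[OF bij_is_inj[OF w(1)], of x "x + 1"] by simp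
      ultimately show ?thesis by simp
    qed
    have mono: "w x < w y" if "x < y" for x y
      using that
    proof (induction y rule: int_gr_induct)
      case (step y)
      thus ?case using up[of y] by simp
    qed (rule up)
    have one: "w (x + 1) = w x + 1" for x
    proof -
      obtain y where y: "w y = w x + 1" using bij_is_surj[OF w(1)] by (metis surjD)
      have "x < y" using y mono[of y x] by (cases x y rule: linorder_cases) auto
      have "\<not> x + 1 < y" using mono[of "x + 1" y] up[of x] y by auto
      with \<open>x < y\<close> have "y = x + 1" by linarith
      thus ?thesis using y by simp
    qed
    have eq: "w x = w 0 + x" for x
    proof (induction x rule: int_induct[where k = 0])
      case (step1 i)
      thus ?case using one[of i] by simp
    next
      case (step2 i)
      thus ?case using one[of "i - 1"] by simp
    qed simp
    have "w i - i = w 0" for i using eq[of i] by simp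
    hence "w 0 = 0" using w(3) assms(1) by simp
    hence "w x = x" for x using eq[of x] by linarith
    hence "w = id" by (simp add: fun_eq_iff)
    thus False using assms(3) by simp
  qed
  thus ?thesis using that by blast
qed

lemma word_prod_append: "word_prod n (us @ vs) = word_prod n us \<circ> word_prod n vs"
  by (induction us) (auto simp: word_prod_def)

lemma expressions_nonempty:
  assumes "n \<ge> 1" "w \<in> affine_sym n"
  shows "expressions n w \<noteq> {}"
  using assms(2)
proof (induction "nat (\<Sum>x = 1..int n. (w x - x)\<^sup>2)" arbitrary: w rule: less_induct)
  case less
  have w: "\<And>x. w (x + int n) = w x + int n"
    using less.prems by (auto simp: affine_sym_iff)
  show ?case
  proof (cases "w = id")
    case True
    hence "[] \<in> expressions n w" by (simp add: expressions_def word_prod_def)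
    thus ?thesis by blast
  next
    case False
    then obtain i where i: "i < n" "w (int i) > w (int i + 1)"
      using affine_sym_descent[OF assms(1) less.prems] by blast
    have n: "n \<ge> 2"
    proof (rule ccontr)
      assume "\<not> n \<ge> 2"
      hence "n = 1" using assms(1) by simp
      thus False using i(2) w[of "int i"] by simp
    qed
    define w' where "w' = w \<circ> simple_gen n i"
    have w': "w' \<in> affine_sym n"
      unfolding w'_def by (rule affine_sym_comp_simple_gen[OF n less.prems])
    have "(\<Sum>x = 1..int n. (w' x - x)\<^sup>2) =
       (\<Sum>x = 1..int n. (w x - x)\<^sup>2) - 2 * (w (int i) - w (int i + 1))"
      using sum_comp_simple_gen[of n "\<lambda>y x. (y - x)\<^sup>2" w i, OF n _ w]
      by (simp add: w'_def power2_eq_square algebra_simps)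
    moreover have "(\<Sum>x = 1..int n. (w' x - x)\<^sup>2) \<ge> 0" by (intro sum_nonneg) simp
    ultimately have "expressions n w' \<noteq> {}"
      using less.hyps[OF _ w'] i(2) by simp
    then obtain us where us: "set us \<subseteq> gen_index n" "word_prod n us = w'"
      by (auto simp: expressions_def)
    have "word_prod n (us @ [i]) = w"
      unfolding word_prod_append us(2)
      by (simp add: w'_def word_prod_def fun_eq_iff simple_gen_involution[OF n])
    hence "us @ [i] \<in> expressions n w"
      using us(1) i(1) n by (simp add: expressions_def gen_index_def)
    thus ?thesis by blast
  qed
qed

lemma reduced_expressions_nonempty:
  assumes "n \<ge> 1" "w \<in> affine_sym n"
  shows "reduced_expressions n w \<noteq> {}"
proof -
  have "\<exists>l. \<exists>us \<in> expressions n w. length us = l"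
    using expressions_nonempty[OF assms] by blast
  from LeastI_ex[OF this] show ?thesis
    by (auto simp: reduced_expressions_def cox_length_def)
qed

lemma finite_fc_of_length:
  assumes "n \<ge> 1"
  shows "finite (fc_of_length n i)"
proof (rule finite_subset)
  show "fc_of_length n i \<subseteq> word_prod n ` {us. set us \<subseteq> gen_index n \<and> length us = i}"
  proof
    fix w assume w: "w \<in> fc_of_length n i"
    hence "w \<in> affine_sym n" by (simp add: fc_of_length_def fully_commutative_def)
    from reduced_expressions_nonempty[OF assms this]
    obtain us where "us \<in> reduced_expressions n w" by blast
    with w show "w \<in> word_prod n ` {us. set us \<subseteq> gen_index n \<and> length us = i}"
      by (auto simp: reduced_expressions_def expressions_def fc_of_length_def)
  qed
  show "finite (word_prod n ` {us. set us \<subseteq> gen_index n \<and> length us = i})"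
    by (intro finite_imageI finite_lists_length_eq) (simp add: gen_index_def)
qed

end

theory Submission
  imports Defs
begin

text \<open>
  The fully commutative elements are those avoiding the pattern 321: two distinct descents of an
  avoiding \<open>w\<close> commute, while a 321 pattern can be shortened until it yields a braid, and hence two
  reduced expressions with different letter counts, which commutations preserve. An element avoids
  321 iff it is increasing on the positions with \<open>w x > x\<close> and on those with \<open>w x \<le> x\<close>, and then
  its length is the sum of the positive displacements over a window. For large length \<open>N\<close> such an
  element is determined by the residues \<open>A\<close> of the first kind of positions and the residues \<open>B\<close>
  of their values, and the pairs that occur are those with \<open>card A = card B\<close> strictly between \<open>0\<close>
  and \<open>n\<close> and \<open>N + \<Sum>A \<equiv> \<Sum>B\<close> modulo \<open>n\<close>; this is periodic in \<open>N\<close>. For prime \<open>n\<close>, rotating \<open>A\<close>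
  by one changes \<open>\<Sum>A\<close> by \<open>card A\<close>, which is invertible modulo \<open>n\<close>, so the pairs, whose number is
  \<open>(2 n choose n) - 2\<close> by Vandermonde, are spread evenly over the residue classes.
\<close>

subsection \<open>Descents and the exchange condition\<close>

lemma affine_symD:
  assumes "w \<in> affine_sym n"
  shows "bij w" "w (x + int n) = w x + int n" "(\<Sum>i = 1..int n. w i - i) = 0"
  using assms by (auto simp: affine_sym_iff)

lemma affine_sym_eq_iff: "w \<in> affine_sym n \<Longrightarrow> w x = w y \<longleftrightarrow> x = y"
  by (meson affine_symD(1) bij_is_inj inj_eq)

lemma periodic_shift:
  fixes w :: "int \<Rightarrow> int"
  assumes "\<And>x. w (x + int n) = w x + int n"
  shows "w (x + k * int n) = w x + k * int n"
proof (induction k rule: int_induct[where k = 0])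
  case (step1 i)
  thus ?case using assms[of "x + i * int n"] by (simp add: algebra_simps)
next
  case (step2 i)
  thus ?case using assms[of "x + (i - 1) * int n"] by (simp add: algebra_simps)
qed simp

lemma affine_sym_shift: "w \<in> affine_sym n \<Longrightarrow> w (x + k * int n) = w x + k * int n"
  by (rule periodic_shift) (rule affine_symD(2))

lemma simple_gen_left: "simple_gen n i (int i + k * int n) = int i + 1 + k * int n"
  by (auto simp: simple_gen_def)

lemma simple_gen_right:
  assumes "n \<ge> 2"
  shows "simple_gen n i (int i + 1 + k * int n) = int i + k * int n"
  using simple_gen_involution[OF assms, of i "int i + k * int n"] by (simp add: simple_gen_left)

text \<open>A generator moves every integer by at most 1, so only gaps 1 and 2 matter; at gap 2 the
  two points could only meet if \<open>n\<close> divided 1.\<close>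

lemma simple_gen_less:
  assumes n: "n \<ge> 2" and xy: "x < y" and ne: "y = x + 1 \<Longrightarrow> x mod int n \<noteq> int i mod int n"
  shows "simple_gen n i x < simple_gen n i y"
proof -
  have b: "\<bar>simple_gen n i z - z\<bar> \<le> 1" for z
    by (simp add: simple_gen_def)
  consider "y = x + 1" | "y = x + 2" | "y \<ge> x + 3" using xy by linarith
  thus ?thesis
  proof cases
    case 1
    have "(x + 1) mod int n \<noteq> (int i + 1) mod int n"
      using ne[OF 1] by (simp add: mod_eq_dvd_iff)
    thus ?thesis using ne[OF 1] by (auto simp: 1 simple_gen_altdef[OF n])
  next
    case 2
    have "\<not> (x mod int n = int i mod int n \<and> (x + 2) mod int n = (int i + 1) mod int n)"
    proof
      assume "x mod int n = int i mod int n \<and> (x + 2) mod int n = (int i + 1) mod int n"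
      hence "int n dvd x - int i" "int n dvd x + 2 - (int i + 1)"
        by (simp_all only: mod_eq_dvd_iff)
      hence "int n dvd (x + 2 - (int i + 1)) - (x - int i)"
        by (rule dvd_diff[rotated])
      thus False using n by simp
    qed
    thus ?thesis by (auto simp: 2 simple_gen_altdef[OF n])
  qed (use b[of x] b[of y] in linarith)
qed

text \<open>A reflection conjugated by \<open>v\<close> is the reflection exchanging the images
  under \<open>v\<close>. The exchange condition, the braid relation and the commutation of descents
  all rest on this.\<close>

lemma simple_gen_conjugate:
  assumes n: "n \<ge> 2" and v: "v \<in> affine_sym n"
    and vi: "v (int i) = int u + k * int n" "v (int i + 1) = int u + 1 + k * int n"
  shows "simple_gen n u \<circ> v = v \<circ> simple_gen n i"
proof
  fix x
  note shift = affine_sym_shift[OF v]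
  show "(simple_gen n u \<circ> v) x = (v \<circ> simple_gen n i) x"
  proof -
    consider (a) m where "x = int i + m * int n" | (b) m where "x = int i + 1 + m * int n"
      | (c) "\<nexists>m. x = int i + m * int n" "\<nexists>m. x = int i + 1 + m * int n" by blast
    thus ?thesis
    proof cases
      case a
      have "v x = int u + (k + m) * int n" "v (int i + 1 + m * int n) = int u + 1 + (k + m) * int n"
        using vi shift[of "int i" m] shift[of "int i + 1" m] by (simp_all add: a algebra_simps)
      thus ?thesis using a by (simp add: simple_gen_left)
    next
      case b
      have "v x = int u + 1 + (k + m) * int n" "v (int i + m * int n) = int u + (k + m) * int n"
        using vi shift[of "int i" m] shift[of "int i + 1" m] by (simp_all add: b algebra_simps)
      thus ?thesis using b by (simp add: simple_gen_right[OF n])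
    next
      case c
      have "v x \<noteq> int u + m * int n" for m
      proof
        assume "v x = int u + m * int n"
        hence "v x = v (int i + (m - k) * int n)" unfolding shift vi by (simp add: algebra_simps)
        thus False using c affine_sym_eq_iff[OF v] by blast
      qed
      moreover have "v x \<noteq> int u + 1 + m * int n" for m
      proof
        assume "v x = int u + 1 + m * int n"
        hence "v x = v (int i + 1 + (m - k) * int n)" unfolding shift vi by (simp add: algebra_simps)
        thus False using c affine_sym_eq_iff[OF v] by blast
      qed
      ultimately show ?thesis using c by (simp add: simple_gen_def)
    qed
  qed
qed

section \<open>Words, reduced expressions and descents\<close>

lemma id_in_affine_sym: "id \<in> affine_sym n"
  by (simp add: affine_sym_iff)

lemma word_prod_Nil [simp]: "word_prod n [] = id"
  by (simp add: word_prod_def)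

lemma word_prod_Cons: "word_prod n (i # us) = simple_gen n i \<circ> word_prod n us"
  by (simp add: word_prod_def)

lemma word_prod_snoc: "word_prod n (us @ [i]) = word_prod n us \<circ> simple_gen n i"
  by (simp add: word_prod_append word_prod_Cons)

lemma word_prod_in_affine_sym:
  assumes "n \<ge> 2"
  shows "word_prod n us \<in> affine_sym n"
proof (induction us rule: rev_induct)
  case (snoc i us)
  thus ?case unfolding word_prod_snoc by (rule affine_sym_comp_simple_gen[OF assms])
qed (simp only: word_prod_Nil id_in_affine_sym)

lemma comp_simple_gen_cancel:
  assumes "n \<ge> 2"
  shows "w \<circ> simple_gen n i \<circ> simple_gen n i = w"
  by (simp add: fun_eq_iff simple_gen_involution[OF assms])

lemma comp_simple_gen_at:
  assumes "n \<ge> 2"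
  shows "(w \<circ> simple_gen n i) (int i) = w (int i + 1)" "(w \<circ> simple_gen n i) (int i + 1) = w (int i)"
  using simple_gen_left[of n i 0] simple_gen_right[OF assms, of i 0] by simp_all

text \<open>The exchange condition: applying the letters from right to left to \<open>i\<close> and \<open>i + 1\<close>,
  their order is reversed by some letter, which can then be traded for a final \<open>i\<close>.\<close>

lemma exchange:
  assumes n: "n \<ge> 2" and desc: "word_prod n us (int i) > word_prod n us (int i + 1)"
  shows "\<exists>vs. length us = Suc (length vs) \<and> set vs \<subseteq> set us \<and>
    word_prod n vs = word_prod n us \<circ> simple_gen n i"
  using desc
proof (induction us)
  case (Cons u us)
  let ?v = "word_prod n us"
  have v: "?v \<in> affine_sym n" by (rule word_prod_in_affine_sym[OF n])
  show ?case
  proof (cases "?v (int i) > ?v (int i + 1)")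
    case True
    then obtain vs where "length us = Suc (length vs)" "set vs \<subseteq> set us"
      "word_prod n vs = ?v \<circ> simple_gen n i" using Cons.IH by blast
    thus ?thesis by (intro exI[of _ "u # vs"]) (auto simp: word_prod_Cons comp_assoc)
  next
    case False
    hence less: "?v (int i) < ?v (int i + 1)"
      using affine_sym_eq_iff[OF v, of "int i" "int i + 1"] by linarith
    have "\<not> simple_gen n u (?v (int i)) < simple_gen n u (?v (int i + 1))"
      using Cons.prems by (simp add: word_prod_Cons)
    with simple_gen_less[OF n less, of u]
    have eq: "?v (int i + 1) = ?v (int i) + 1" "?v (int i) mod int n = int u mod int n" by blast+
    then obtain k where "?v (int i) = int u + k * int n"
      by (auto simp: mod_eq_dvd_iff dvd_def algebra_simps)
    hence "simple_gen n u \<circ> ?v = ?v \<circ> simple_gen n i"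
      using eq(1) by (intro simple_gen_conjugate[OF n v, of i u k]) auto
    hence "?v = word_prod n (u # us) \<circ> simple_gen n i"
      by (simp add: word_prod_Cons comp_simple_gen_cancel[OF n])
    thus ?thesis by (intro exI[of _ us]) auto
  qed
qed simp

lemma cox_length_le: "us \<in> expressions n w \<Longrightarrow> cox_length n w \<le> length us"
  unfolding cox_length_def by (rule Least_le) blast

lemma cox_length_id [simp]: "cox_length n id = 0"
  using cox_length_le[of "[]" n id] by (simp add: expressions_def)

lemma obtain_reduced:
  assumes "n \<ge> 1" "w \<in> affine_sym n"
  obtains us where "us \<in> reduced_expressions n w"
  using reduced_expressions_nonempty[OF assms] by blast

lemma cox_length_comp_le:
  assumes "n \<ge> 2" "w \<in> affine_sym n" "i < n"
  shows "cox_length n (w \<circ> simple_gen n i) \<le> Suc (cox_length n w)"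
proof -
  obtain us where us: "us \<in> reduced_expressions n w"
    using obtain_reduced[of n w] assms by auto
  hence "us @ [i] \<in> expressions n (w \<circ> simple_gen n i)"
    using assms by (auto simp: reduced_expressions_def expressions_def word_prod_snoc gen_index_def)
  thus ?thesis using cox_length_le us by (fastforce simp: reduced_expressions_def)
qed

text \<open>The exchange condition turns a reduced expression into a shorter one for
  \<open>w \<circ> simple_gen n i\<close>; appending \<open>i\<close> again shows that the drop is
  exactly one.\<close>

lemma cox_length_descent:
  assumes n: "n \<ge> 2" and w: "w \<in> affine_sym n" and i: "i < n" and desc: "w (int i) > w (int i + 1)"
  shows "cox_length n w = Suc (cox_length n (w \<circ> simple_gen n i))"
proof -
  obtain us where us: "us \<in> reduced_expressions n w"
    using obtain_reduced[of n w] n w by auto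
  then obtain vs where "length us = Suc (length vs)" "set vs \<subseteq> set us"
    "word_prod n vs = w \<circ> simple_gen n i"
    using exchange[OF n, of us i] desc by (auto simp: reduced_expressions_def expressions_def)
  hence "cox_length n (w \<circ> simple_gen n i) < cox_length n w"
    using us cox_length_le[of vs n "w \<circ> simple_gen n i"]
    by (force simp: reduced_expressions_def expressions_def)
  moreover have "cox_length n w \<le> Suc (cox_length n (w \<circ> simple_gen n i))"
    using cox_length_comp_le[OF n affine_sym_comp_simple_gen[OF n w, of i] i]
    by (simp add: comp_simple_gen_cancel[OF n])
  ultimately show ?thesis by simp
qed

lemma reduced_snocI:
  assumes n: "n \<ge> 2" and w: "w \<in> affine_sym n" and i: "i < n" and desc: "w (int i) > w (int i + 1)"
    and us: "us \<in> reduced_expressions n (w \<circ> simple_gen n i)"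
  shows "us @ [i] \<in> reduced_expressions n w"
  using us i n cox_length_descent[OF n w i desc]
  by (auto simp: reduced_expressions_def expressions_def word_prod_snoc gen_index_def
      comp_simple_gen_cancel)

text \<open>Were \<open>i\<close> an ascent of \<open>w\<close>, it would be a descent of the
  product of \<open>us\<close>, which would then be longer than \<open>w\<close>, although
  \<open>us\<close> is the shorter word.\<close>

lemma reduced_snocD:
  assumes n: "n \<ge> 2" and us: "us @ [i] \<in> reduced_expressions n w"
  shows "i < n" "w (int i) > w (int i + 1)" "us \<in> reduced_expressions n (w \<circ> simple_gen n i)"
proof -
  have w: "w = word_prod n us \<circ> simple_gen n i" and len: "cox_length n w = Suc (length us)"
    and set: "set us \<subseteq> gen_index n"
    using us by (auto simp: reduced_expressions_def expressions_def word_prod_snoc)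
  show i: "i < n"
    using us n by (auto simp: reduced_expressions_def expressions_def gen_index_def)
  have v: "w \<circ> simple_gen n i = word_prod n us"
    by (simp add: w comp_simple_gen_cancel[OF n])
  have waff: "w \<in> affine_sym n"
    unfolding w by (intro affine_sym_comp_simple_gen[OF n] word_prod_in_affine_sym[OF n])
  have le: "cox_length n (word_prod n us) \<le> length us"
    by (rule cox_length_le) (use set in \<open>simp add: expressions_def\<close>)
  show desc: "w (int i) > w (int i + 1)"
  proof (rule ccontr)
    assume "\<not> ?thesis"
    hence "w (int i) < w (int i + 1)"
      using affine_sym_eq_iff[OF waff, of "int i" "int i + 1"] by linarith
    hence "word_prod n us (int i) > word_prod n us (int i + 1)"
      unfolding v[symmetric] comp_simple_gen_at[OF n] .
    from cox_length_descent[OF n word_prod_in_affine_sym[OF n] i this]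
    show False using le len w by simp
  qed
  show "us \<in> reduced_expressions n (w \<circ> simple_gen n i)"
    using cox_length_descent[OF n waff i desc] len set
    by (simp add: v reduced_expressions_def expressions_def)
qed

subsection \<open>Full commutativity as 321-avoidance\<close>

lemma commutation_step_append:
  "(us, vs) \<in> (commutation_step n)\<^sup>* \<Longrightarrow> (us @ ws, vs @ ws) \<in> (commutation_step n)\<^sup>*"
proof (induction rule: rtrancl_induct)
  case (step vs vs')
  from step(2) have "(vs @ ws, vs' @ ws) \<in> commutation_step n"
    unfolding commutation_step_def by fastforce
  with step(3) show ?case by (rule rtrancl_into_rtrancl)
qed simp

text \<open>Commutations only permute a word, so different letter counts certify that two
  expressions are not connected.\<close>

lemma commutation_step_count_list:
  "(us, vs) \<in> (commutation_step n)\<^sup>* \<Longrightarrow> count_list us i = count_list vs i"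
  by (induction rule: rtrancl_induct) (auto simp: commutation_step_def)

text \<open>The three positions range over all integers, since a pattern need not fit into one
  window of length \<open>n\<close>.\<close>

definition avoids_321 :: "(int \<Rightarrow> int) \<Rightarrow> bool" where
  "avoids_321 w \<longleftrightarrow> (\<nexists>x y z. x < y \<and> y < z \<and> w x > w y \<and> w y > w z)"

text \<open>On a residue class \<open>w\<close> is a translation, hence increasing.\<close>

lemma descent_not_congruent:
  assumes w: "w \<in> affine_sym n" and "x < y" "w x > w y"
  shows "x mod int n \<noteq> y mod int n"
proof
  assume "x mod int n = y mod int n"
  then obtain k where k: "y = x + k * int n"
    by (metis add.commute diff_add_cancel dvd_div_mult_self mod_eq_dvd_iff)
  have "k * int n > 0" using k assms(2) by simp
  thus False using affine_sym_shift[OF w, of x k] assms(3) unfolding k by linarith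
qed

text \<open>Undoing a descent creates no inversion: \<open>simple_gen n i\<close> carries inversions
  of the new map, in order, to inversions of \<open>w\<close>, and so would carry a 321 pattern to
  one.\<close>

lemma avoids_321_descent:
  assumes n: "n \<ge> 2" and w: "w \<in> affine_sym n" and av: "avoids_321 w"
    and desc: "w (int i) > w (int i + 1)"
  shows "avoids_321 (w \<circ> simple_gen n i)"
proof (rule ccontr)
  let ?s = "simple_gen n i" and ?v = "w \<circ> simple_gen n i"
  assume "\<not> ?thesis"
  then obtain x y z where xyz: "x < y" "y < z" "?v x > ?v y" "?v y > ?v z"
    by (auto simp: avoids_321_def)
  have mono: "?s a < ?s b" if "a < b" "?v a > ?v b" for a b
  proof (rule simple_gen_less[OF n \<open>a < b\<close>])
    assume b: "b = a + 1"
    \<comment> \<open>The only pairs reversed by the generator are the translates of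
      \<open>i\<close>, \<open>i + 1\<close>, and there the descent has become an ascent.\<close>
    show "a mod int n \<noteq> int i mod int n"
    proof
      assume "a mod int n = int i mod int n"
      then obtain k where k: "a = int i + k * int n"
        by (metis add.commute diff_add_cancel dvd_div_mult_self mod_eq_dvd_iff)
      have "?v a = w (int i + 1 + k * int n)" "?v b = w (int i + k * int n)"
        using simple_gen_left[of n i k] simple_gen_right[OF n, of i k]
        by (simp_all add: b k algebra_simps)
      thus False using that(2) desc by (simp add: affine_sym_shift[OF w])
    qed
  qed
  have "?s x < ?s y" "?s y < ?s z" using mono xyz by blast+
  thus False using av xyz unfolding avoids_321_def by auto
qed

text \<open>The two expressions end in \<open>iji\<close> and \<open>jij\<close>, where \<open>j = i + 1\<close> modulo \<open>n\<close>.\<close>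

lemma braid_reduced:
  assumes n: "n \<ge> 2" and w: "w \<in> affine_sym n" and i: "i < n"
    and desc: "w (int i) > w (int i + 1)" "w (int i + 1) > w (int i + 2)"
  shows "\<exists>us \<in> reduced_expressions n w. \<exists>vs \<in> reduced_expressions n w.
    count_list us i \<noteq> count_list vs i"
proof -
  \<comment> \<open>For \<open>n = 2\<close> the position \<open>i + 2\<close> is \<open>i\<close>
    shifted by a period, so its value exceeds \<open>w i\<close> and two descents in a row are
    impossible.\<close>
  have n3: "n \<ge> 3"
  proof (rule ccontr)
    assume "\<not> n \<ge> 3"
    hence "n = 2" using n by simp
    thus False using desc affine_symD(2)[OF w, of "int i"] by simp
  qed
  \<comment> \<open>The generator after the last one is number 0; \<open>d\<close> then records that
    position \<open>i + 1\<close> is \<open>j\<close> shifted by one period.\<close>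
  define j where "j = (if Suc i = n then 0 else Suc i)"
  define d where "d = (if Suc i = n then 1 else 0 :: int)"
  have j: "j < n" and ij: "i \<noteq> j" using i n by (auto simp: j_def)
  have jd: "int i + 1 = int j + d * int n" by (auto simp: j_def d_def)
  let ?si = "simple_gen n i" and ?sj = "simple_gen n j"
  have jd2: "int i + 2 = int j + 1 + d * int n" using jd by simp
  have "?si (int i) = int i + 1" "?si (int i + 1) = int i"
    using simple_gen_left[of n i 0] simple_gen_right[OF n, of i 0] by simp_all
  moreover have "?sj (int i + 1) = int i + 2" "?sj (int i + 2) = int i + 1"
    unfolding jd jd2 by (rule simple_gen_left simple_gen_right[OF n])+
  ultimately have s: "?si (int i) = int i + 1" "?si (int i + 1) = int i"
    "?sj (int i + 1) = int i + 2" "?sj (int i + 2) = int i + 1" by simp_all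
  have s': "?sj (int i) = int i" "?si (int i + 2) = int i + 2"
  proof -
    have "\<not> int n dvd 1" "\<not> int n dvd 2" using n3 by (auto dest: zdvd_imp_le)
    have "int i mod int n \<noteq> (int i + 1) mod int n" "int i mod int n \<noteq> (int i + 2) mod int n"
      "(int i + 2) mod int n \<noteq> (int i + 1) mod int n"
      using \<open>\<not> int n dvd 1\<close> \<open>\<not> int n dvd 2\<close> by (simp_all add: mod_eq_dvd_iff)
    moreover have "int j mod int n = (int i + 1) mod int n"
      "(int j + 1) mod int n = (int i + 2) mod int n"
    proof -
      show "int j mod int n = (int i + 1) mod int n" unfolding jd by simp
      show "(int j + 1) mod int n = (int i + 2) mod int n" unfolding jd2 by simp
    qed
    ultimately show "?sj (int i) = int i" "?si (int i + 2) = int i + 2"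
      by (simp_all add: simple_gen_altdef[OF n])
  qed
  have shift: "u (int j) > u (int j + 1) \<longleftrightarrow> u (int i + 1) > u (int i + 2)"
    if "u \<in> affine_sym n" for u
  proof -
    have "u (int i + 1) = u (int j) + d * int n" "u (int i + 2) = u (int j + 1) + d * int n"
      unfolding jd jd2 by (rule affine_sym_shift[OF that])+
    thus ?thesis by simp
  qed
  note aff = affine_sym_comp_simple_gen[OF n]
  define v where "v = w \<circ> ?si \<circ> ?sj \<circ> ?si"
  \<comment> \<open>The braid relation as an instance of conjugation: applying \<open>j\<close> and
    then \<open>i\<close> carries the positions \<open>i\<close>, \<open>i + 1\<close> to
    \<open>i + 1\<close>, \<open>i + 2\<close>.\<close>
  have "?sj \<circ> (?si \<circ> ?sj) = (?si \<circ> ?sj) \<circ> ?si"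
    using word_prod_in_affine_sym[OF n, of "[i, j]"] s s' jd
    by (intro simple_gen_conjugate[OF n, of _ i j d]) (auto simp: word_prod_Cons)
  hence v': "v = w \<circ> ?sj \<circ> ?si \<circ> ?sj" by (simp add: v_def comp_assoc)
  have vaff: "v \<in> affine_sym n" unfolding v_def by (intro aff w)
  obtain us where us: "us \<in> reduced_expressions n v"
    using obtain_reduced[OF _ vaff] n by auto
  have "us @ [i] \<in> reduced_expressions n (w \<circ> ?si \<circ> ?sj)"
    by (rule reduced_snocI[OF n aff[OF aff[OF w]] i]) (use us desc s s' in \<open>simp_all add: v_def\<close>)
  hence "(us @ [i]) @ [j] \<in> reduced_expressions n (w \<circ> ?si)"
    by (intro reduced_snocI[OF n aff[OF w] j]) (use desc s s' shift[OF aff[OF w, of i]] in auto)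
  hence 1: "((us @ [i]) @ [j]) @ [i] \<in> reduced_expressions n w"
    by (intro reduced_snocI[OF n w i]) (use desc in auto)
  have "us @ [j] \<in> reduced_expressions n (w \<circ> ?sj \<circ> ?si)"
    by (rule reduced_snocI[OF n aff[OF aff[OF w]] j])
      (use us desc s s' shift[OF aff[OF aff[OF w, of j], of i]] in \<open>simp_all add: v'\<close>)
  hence "(us @ [j]) @ [i] \<in> reduced_expressions n (w \<circ> ?sj)"
    by (intro reduced_snocI[OF n aff[OF w] i]) (use desc s s' in auto)
  hence 2: "((us @ [j]) @ [i]) @ [j] \<in> reduced_expressions n w"
    by (intro reduced_snocI[OF n w j]) (use desc shift[OF w] in auto)
  show ?thesis using 1 2 ij by (intro bexI[OF _ 1] bexI[OF _ 2]) simp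
qed

text \<open>In a 321 pattern \<open>x < y < z\<close> of minimal width, \<open>x\<close> or \<open>z - 1\<close> is a descent that can be
  removed without destroying the pattern, unless \<open>x\<close>, \<open>y\<close>, \<open>z\<close> are consecutive.\<close>

lemma distinct_counts_of_321:
  assumes n: "n \<ge> 2" and w: "w \<in> affine_sym n" and av: "\<not> avoids_321 w"
  shows "\<exists>us \<in> reduced_expressions n w. \<exists>vs \<in> reduced_expressions n w.
    \<exists>i. count_list us i \<noteq> count_list vs i"
  using w av
proof (induction "cox_length n w" arbitrary: w rule: less_induct)
  case less
  note w = less.prems(1)
  define pat where "pat = (\<lambda>x y z. x < y \<and> y < z \<and> w x > w y \<and> w y > w z)"
  have "\<exists>l x y z. pat x y z \<and> nat (z - x) = l"
    using less.prems(2) by (auto simp: avoids_321_def pat_def)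
  then obtain l where "\<exists>x y z. pat x y z \<and> nat (z - x) = l"
    and least: "\<And>m. m < l \<Longrightarrow> \<not> (\<exists>x y z. pat x y z \<and> nat (z - x) = m)"
    using exists_least_iff[of "\<lambda>l. \<exists>x y z. pat x y z \<and> nat (z - x) = l"] by blast
  then obtain x y z where pat: "pat x y z" and l: "nat (z - x) = l" by blast
  have xyz: "x < y" "y < z" "w x > w y" "w y > w z" using pat by (auto simp: pat_def)
  have least: "\<not> pat x' y' z'" if "x' \<ge> x" "z' \<le> z" "z' - x' < z - x" "x' < z'" for x' y' z'
  proof -
    have "nat (z' - x') < l" using that l xyz by auto
    thus ?thesis using least by blast
  qed
  have norm: "\<exists>i k. i < n \<and> p = int i + k * int n" for p
    using n by (intro exI[of _ "nat (p mod int n)"] exI[of _ "p div int n"]) (simp add: nat_less_iff)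
  \<comment> \<open>The side conditions keep the exchanged pair from being \<open>x\<close>,
    \<open>y\<close> or \<open>y\<close>, \<open>z\<close>; the pattern then survives in a shorter
    element, to which the induction hypothesis applies.\<close>
  have swap: ?case if p: "w p > w (p + 1)" and pd: "p + 1 \<noteq> y \<or> p \<noteq> x" "p + 1 \<noteq> z \<or> p \<noteq> y"
      "p = x \<or> p + 1 = z" for p
  proof -
    obtain i k where i: "i < n" and pk: "p = int i + k * int n" using norm by blast
    let ?s = "simple_gen n i" and ?v = "w \<circ> simple_gen n i"
    have desc: "w (int i) > w (int i + 1)"
      using p affine_sym_shift[OF w, of "int i" k] affine_sym_shift[OF w, of "int i + 1" k]
      by (simp add: pk algebra_simps)
    have xy: "x mod int n \<noteq> y mod int n" and yz: "y mod int n \<noteq> z mod int n"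
      using descent_not_congruent[OF w] xyz by blast+
    have pi: "p mod int n = int i mod int n" by (simp add: pk)
    \<comment> \<open>If \<open>y = x + 1\<close>, the swap is at \<open>z - 1\<close>. If it also
      reversed \<open>x\<close>, \<open>y\<close>, then \<open>z\<close> would be congruent to
      \<open>y\<close>, which is impossible for an inversion.\<close>
    have ord: "?s x < ?s y"
    proof (rule simple_gen_less[OF n xyz(1)])
      assume y: "y = x + 1"
      hence "p + 1 = z" using pd by auto
      hence "(x + 1) mod int n \<noteq> (p + 1) mod int n" using yz y by simp
      thus "x mod int n \<noteq> int i mod int n" unfolding pi[symmetric] by (simp add: mod_eq_dvd_iff)
    qed
    have ord': "?s y < ?s z"
    proof (rule simple_gen_less[OF n xyz(2)])
      assume z: "z = y + 1"
      hence "p = x" using pd by auto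
      thus "y mod int n \<noteq> int i mod int n" unfolding pi[symmetric] using xy by simp
    qed
    have inv: "?v (?s a) = w a" for a by (simp add: simple_gen_involution[OF n])
    have "\<not> avoids_321 ?v"
      unfolding avoids_321_def not_not
      by (intro exI[of _ "?s x"] exI[of _ "?s y"] exI[of _ "?s z"]) (use ord ord' xyz inv in simp)
    moreover have "cox_length n ?v < cox_length n w"
      using cox_length_descent[OF n w i desc] by simp
    ultimately obtain us vs j where "us \<in> reduced_expressions n ?v" "vs \<in> reduced_expressions n ?v"
      "count_list us j \<noteq> count_list vs j"
      using less.hyps affine_sym_comp_simple_gen[OF n w] by blast
    thus ?thesis
      by (intro bexI[of _ "us @ [i]"] bexI[of _ "vs @ [i]"] exI[of _ j])
        (auto intro: reduced_snocI[OF n w i desc])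
  qed
  show ?case
  proof (cases "y = x + 1 \<and> z = y + 1")
    case True
    obtain i k where i: "i < n" and xk: "x = int i + k * int n" using norm by blast
    have "w (int i) > w (int i + 1)" "w (int i + 1) > w (int i + 2)"
      using xyz True affine_sym_shift[OF w, of "int i" k] affine_sym_shift[OF w, of "int i + 1" k]
        affine_sym_shift[OF w, of "int i + 2" k]
      by (simp_all add: xk algebra_simps)
    from braid_reduced[OF n w i this] show ?thesis by blast
  next
    case False
    show ?thesis
    proof (cases "y = x + 1")
      case True
      hence "y < z - 1" using False xyz by auto
      \<comment> \<open>Otherwise \<open>x\<close>, \<open>y\<close>, \<open>z - 1\<close> would be
        a narrower pattern. Hence \<open>w (z - 1) \<ge> w y > w z\<close>, so \<open>z - 1\<close>
        is a descent.\<close>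
      hence "\<not> w y > w (z - 1)" using least[of x "z - 1" y] xyz by (auto simp: pat_def)
      thus ?thesis using swap[of "z - 1"] xyz False True by auto
    next
      case ne: False
      hence "x + 1 < y" using xyz by auto
      hence "\<not> w (x + 1) > w y" using least[of "x + 1" z y] xyz by (auto simp: pat_def)
      thus ?thesis using swap[of x] xyz ne by auto
    qed
  qed
qed

text \<open>Two descents at neighbouring positions modulo \<open>n\<close> would line up to a 321
  pattern, so distinct descents act on disjoint sets of positions.\<close>

lemma descents_commute:
  assumes n: "n \<ge> 2" and w: "w \<in> affine_sym n" and av: "avoids_321 w" and ij: "i < n" "j < n" "i \<noteq> j"
    and desc: "w (int i) > w (int i + 1)" "w (int j) > w (int j + 1)"
  shows "simple_gen n i \<circ> simple_gen n j = simple_gen n j \<circ> simple_gen n i"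
    and "simple_gen n i (int j) = int j" "simple_gen n i (int j + 1) = int j + 1"
proof -
  have adj: False if ab: "w (int a) > w (int a + 1)" "w (int b) > w (int b + 1)"
    "int b mod int n = (int a + 1) mod int n" for a b
  proof -
    obtain k where k: "int b = int a + 1 + k * int n"
      using ab(3) by (metis add.commute diff_add_cancel dvd_div_mult_self mod_eq_dvd_iff)
    have "w (int a + 1) > w (int a + 2)"
      using ab(2) affine_sym_shift[OF w, of "int a + 1" k] affine_sym_shift[OF w, of "int a + 2" k]
      by (simp add: k algebra_simps)
    hence "\<exists>x y z. x < y \<and> y < z \<and> w x > w y \<and> w y > w z"
      using ab(1) by (intro exI[of _ "int a"] exI[of _ "int a + 1"] exI[of _ "int a + 2"]) simp
    thus False using av unfolding avoids_321_def by blast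
  qed
  have ne: "int j mod int n \<noteq> int i mod int n" using ij by simp
  moreover have "int j mod int n \<noteq> (int i + 1) mod int n" "int i mod int n \<noteq> (int j + 1) mod int n"
    using adj[of i j] adj[of j i] desc by auto
  moreover have "(int j + 1) mod int n \<noteq> (int i + 1) mod int n"
    using ne by (simp add: mod_eq_dvd_iff)
  ultimately show fixed: "simple_gen n i (int j) = int j" "simple_gen n i (int j + 1) = int j + 1"
    by (simp_all add: simple_gen_altdef[OF n])
  have "simple_gen n j \<circ> simple_gen n i = simple_gen n i \<circ> simple_gen n j"
    using word_prod_in_affine_sym[OF n, of "[i]"] fixed
    by (intro simple_gen_conjugate[OF n, of _ j j 0]) (auto simp: word_prod_Cons)
  thus "simple_gen n i \<circ> simple_gen n j = simple_gen n j \<circ> simple_gen n i" by simp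
qed

text \<open>A diamond argument: reduced expressions with distinct last letters \<open>i\<close> and
  \<open>j\<close> are linked, by induction on length, to expressions ending in
  \<open>[j, i]\<close> and \<open>[i, j]\<close>, which are one commutation apart.\<close>

lemma avoids_321_connected:
  assumes n: "n \<ge> 2" and w: "w \<in> affine_sym n" and av: "avoids_321 w"
    and red: "us \<in> reduced_expressions n w" "vs \<in> reduced_expressions n w"
  shows "(us, vs) \<in> (commutation_step n)\<^sup>*"
  using w av red
proof (induction "cox_length n w" arbitrary: w us vs rule: less_induct)
  case less
  note w = less.prems(1) and av = less.prems(2)
  note aff = affine_sym_comp_simple_gen[OF n]
  have len: "length us = length vs"
    using less.prems by (simp add: reduced_expressions_def)
  show ?case
  proof (cases us rule: rev_cases)
    case Nil
    thus ?thesis using len by simp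
  next
    case us: (snoc us' i)
    then obtain vs' j where vs: "vs = vs' @ [j]" using len by (cases vs rule: rev_cases) auto
    note ri = reduced_snocD[OF n less.prems(3)[unfolded us]]
    note rj = reduced_snocD[OF n less.prems(4)[unfolded vs]]
    note li = cox_length_descent[OF n w ri(1,2)] and lj = cox_length_descent[OF n w rj(1,2)]
    note avi = avoids_321_descent[OF n w av ri(2)] and avj = avoids_321_descent[OF n w av rj(2)]
    show ?thesis
    proof (cases "i = j")
      case True
      have "(us', vs') \<in> (commutation_step n)\<^sup>*"
        using less.hyps[OF _ aff[OF w] avi ri(3)] rj(3) li True by auto
      thus ?thesis unfolding us vs True by (rule commutation_step_append)
    next
      case False
      let ?si = "simple_gen n i" and ?sj = "simple_gen n j"
      note cij = descents_commute[OF n w av ri(1) rj(1) False ri(2) rj(2)]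
      note cji = descents_commute[OF n w av rj(1) ri(1) False[symmetric] rj(2) ri(2)]
      have desc: "(w \<circ> ?si) (int j) > (w \<circ> ?si) (int j + 1)" "(w \<circ> ?sj) (int i) > (w \<circ> ?sj) (int i + 1)"
        using rj(2) ri(2) by (simp_all add: cij cji)
      have eq: "w \<circ> ?si \<circ> ?sj = w \<circ> ?sj \<circ> ?si" using cij(1) by (simp add: comp_assoc)
      obtain ws where ws: "ws \<in> reduced_expressions n (w \<circ> ?si \<circ> ?sj)"
        using obtain_reduced[OF _ aff[OF aff[OF w]]] n by auto
      have wi: "ws @ [j] \<in> reduced_expressions n (w \<circ> ?si)"
        by (rule reduced_snocI[OF n aff[OF w] rj(1) desc(1) ws])
      have wj: "ws @ [i] \<in> reduced_expressions n (w \<circ> ?sj)"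
        by (rule reduced_snocI[OF n aff[OF w] ri(1) desc(2) ws[unfolded eq]])
      have "(us', ws @ [j]) \<in> (commutation_step n)\<^sup>*"
        using less.hyps[OF _ aff[OF w] avi ri(3) wi] li by simp
      hence "(us, ws @ [j, i]) \<in> (commutation_step n)\<^sup>*"
        using commutation_step_append[of us' "ws @ [j]" n "[i]"] by (simp add: us)
      also have "(ws @ [j, i], ws @ [i, j]) \<in> commutation_step n"
        unfolding commutation_step_def using cji(1) by force
      also have "(ws @ [i], vs') \<in> (commutation_step n)\<^sup>*"
        using less.hyps[OF _ aff[OF w] avj wj rj(3)] lj by simp
      hence "(ws @ [i, j], vs) \<in> (commutation_step n)\<^sup>*"
        using commutation_step_append[of "ws @ [i]" vs' n "[j]"] by (simp add: vs)
      finally show ?thesis .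
    qed
  qed
qed

lemma fully_commutative_iff:
  assumes n: "n \<ge> 2"
  shows "w \<in> fully_commutative n \<longleftrightarrow> w \<in> affine_sym n \<and> avoids_321 w"
  using avoids_321_connected[OF n] distinct_counts_of_321[OF n, of w] commutation_step_count_list
  unfolding fully_commutative_def by blast

subsection \<open>Excedances and length\<close>

text \<open>The elements of \<open>S\<close> outside the interval are as many as those missing from
  it and have the same sum, yet each of the former exceeds each of the latter; so there are
  none.\<close>

lemma set_eq_interval_of_sum:
  fixes S :: "int set"
  assumes fin: "finite S" and card: "card S = L" and gt: "\<And>y. y \<in> S \<Longrightarrow> y > i"
    and sum: "\<Sum>S = \<Sum>{i<..i + int L}"
  shows "S = {i<..i + int L}"
proof -
  let ?J = "{i<..i + int L}"
  have c: "card (S - ?J) = card (?J - S)"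
    using card_Diff_subset_Int[of S ?J] card_Diff_subset_Int[of ?J S] fin card
    by (simp add: Int_commute)
  have "\<Sum>(S - ?J) = \<Sum>(?J - S)"
    using sum sum.Int_Diff[OF fin, of "\<lambda>x. x" ?J] sum.Int_Diff[of ?J "\<lambda>x. x" S]
    by (simp add: Int_commute)
  moreover have "\<Sum>(S - ?J) \<ge> (\<Sum>x\<in>S - ?J. i + int L + 1)"
    using gt by (intro sum_mono) (auto simp: not_le)
  moreover have "\<Sum>(?J - S) \<le> (\<Sum>x\<in>?J - S. i + int L)"
    by (intro sum_mono) auto
  ultimately have "int (card (S - ?J)) * (i + int L + 1) \<le> int (card (?J - S)) * (i + int L)"
    by simp
  hence "card (S - ?J) = 0" unfolding c by (simp add: algebra_simps)
  hence "S \<subseteq> ?J" using fin by simp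
  thus ?thesis using card by (intro card_subset_eq) auto
qed

lemma affine_sym_sum_block:
  assumes "w \<in> affine_sym n"
  shows "(\<Sum>x\<in>{i<..i + int m * int n}. w x - x) = 0"
proof (induction m)
  case (Suc m)
  let ?k = "i + int m * int n"
  have "{i<..i + int (Suc m) * int n} = {i<..?k} \<union> {?k<..?k + int n}"
  proof -
    have "0 \<le> int m * int n" by simp
    moreover have "int (Suc m) * int n = int m * int n + int n" by (simp add: distrib_right)
    ultimately show ?thesis by (simp only: set_eq_iff Un_iff greaterThanAtMost_iff) linarith
  qed
  moreover have "(\<Sum>x\<in>{?k<..?k + int n}. w x - x) = 0"
  proof -
    have "(\<Sum>x = ?k + 1..<?k + 1 + int n. w x - x) = (\<Sum>x = 1..int n. w x - x)"
      by (rule sum_periodic_window) (simp add: affine_symD[OF assms])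
    moreover have "{?k + 1..<?k + 1 + int n} = {?k<..?k + int n}" by auto
    ultimately show ?thesis using affine_symD(3)[OF assms] by simp
  qed
  ultimately show ?case using Suc by (simp add: sum.union_disjoint)
qed simp

text \<open>Since \<open>w\<close> has mean displacement zero, as many values cross a cut downwards as upwards.\<close>

lemma affine_sym_crossing:
  assumes n: "n \<ge> 1" and w: "w \<in> affine_sym n" and x: "x \<le> i" "w x > i"
  obtains z where "z > i" "w z \<le> i"
proof -
  have "\<exists>z>i. w z \<le> i"
  proof (rule ccontr)
    assume no: "\<not> ?thesis"
    \<comment> \<open>After \<open>m\<close> periods the block above the cut contains
      \<open>w x\<close>. If nothing crosses downwards, the sum argument maps the block onto itself,
      so \<open>w x\<close> is also the value of a position above \<open>i\<close>.\<close>
    define m where "m = nat (w x - i)"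
    define L where "L = m * n"
    let ?J = "{i<..i + int L}"
    have "w ` ?J = ?J"
    proof (rule set_eq_interval_of_sum)
      have inj: "inj_on w ?J" by (simp add: inj_on_def affine_sym_eq_iff[OF w])
      show "card (w ` ?J) = L" using card_image[OF inj] by simp
      show "\<Sum>(w ` ?J) = \<Sum>?J"
        using affine_sym_sum_block[OF w, of i m] sum.reindex[OF inj, of "\<lambda>x. x"]
        by (simp add: L_def sum_subtractf)
    qed (use no in \<open>auto simp: not_le\<close>)
    moreover have "int L \<ge> int m" using n unfolding L_def of_nat_le_iff by simp
    hence "w x \<in> ?J" using x by (simp add: m_def)
    ultimately obtain y where "y \<in> ?J" "w x = w y" by (metis imageE)
    thus False using x affine_sym_eq_iff[OF w, of x y] by auto
  qed
  thus ?thesis using that by blast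
qed

text \<open>Conjugation by negation turns upward crossings of a cut into downward ones, which yields
  the opposite crossing statement.\<close>

lemma affine_sym_reflect:
  assumes w: "w \<in> affine_sym n"
  shows "(\<lambda>x. - w (- x)) \<in> affine_sym n"
proof -
  have "bij (\<lambda>x. - w (- x))"
    using bij_comp[OF bij_comp[OF bij_uminus affine_symD(1)[OF w]] bij_uminus]
    by (simp add: comp_def)
  moreover have "- w (- (x + int n)) = - w (- x) + int n" for x
    using affine_symD(2)[OF w, of "- x - int n"] by simp
  moreover have "(\<Sum>x = 1..int n. - w (- x) - x) = 0"
  proof -
    have "(\<Sum>x = 1..int n. - w (- x) - x) = (\<Sum>y = - int n..<- int n + int n. - (w y - y))"
      by (rule sum.reindex_bij_witness[of _ uminus uminus]) auto
    also have "\<dots> = - (\<Sum>y = - int n..<- int n + int n. w y - y)"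
      by (rule sum_negf)
    also have "(\<Sum>y = - int n..<- int n + int n. w y - y) = (\<Sum>x = 1..int n. w x - x)"
      by (rule sum_periodic_window) (simp add: affine_symD(2)[OF w])
    finally show ?thesis using affine_symD(3)[OF w] by simp
  qed
  ultimately show ?thesis by (auto simp: affine_sym_iff)
qed

lemma affine_sym_crossing':
  assumes n: "n \<ge> 1" and w: "w \<in> affine_sym n" and x: "x > i" "w x \<le> i"
  obtains z where "z \<le> i" "w z > i"
proof -
  \<comment> \<open>The cut between \<open>i\<close> and \<open>i + 1\<close> is reflected to the
    one between \<open>- i - 1\<close> and \<open>- i\<close>.\<close>
  obtain z where "z > - i - 1" "- w (- z) \<le> - i - 1"
    using affine_sym_crossing[OF n affine_sym_reflect[OF w], of "- x" "- i - 1"] x by auto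
  thus ?thesis using that[of "- z"] by auto
qed

text \<open>Of three positions two lie in the same class, where there are no inversions. Conversely,
  an inversion inside a class is completed to a 321 pattern by a value crossing a suitable
  cut.\<close>

lemma avoids_321_iff:
  assumes n: "n \<ge> 1" and w: "w \<in> affine_sym n"
  shows "avoids_321 w \<longleftrightarrow>
    strict_mono_on {x. w x > x} w \<and> strict_mono_on {x. w x \<le> x} w"
proof
  assume mono: "strict_mono_on {x. w x > x} w \<and> strict_mono_on {x. w x \<le> x} w"
  show "avoids_321 w"
    unfolding avoids_321_def
  proof safe
    fix x y z assume xyz: "x < y" "y < z" "w x > w y" "w y > w z"
    have no: "\<not> (a \<in> S \<and> b \<in> S)" if "a < b" "w a > w b" "strict_mono_on S w" for a b S
      using that by (metis less_asym strict_mono_onD)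
    have xz: "x < z" "w x > w z" using xyz by auto
    show False
      using mono no[OF xyz(1,3)] no[OF xyz(2,4)] no[OF xz]
      by (metis (no_types, lifting) mem_Collect_eq not_less)
  qed
next
  assume av: "avoids_321 w"
  have no: False if "x < y" "y < z" "w x > w y" "w y > w z" for x y z
    using av that unfolding avoids_321_def by blast
  show "strict_mono_on {x. w x > x} w \<and> strict_mono_on {x. w x \<le> x} w"
  proof (intro conjI strict_mono_onI)
    fix x y assume xy: "x \<in> {x. w x > x}" "y \<in> {x. w x > x}" "x < y"
    show "w x < w y"
    proof (rule ccontr)
      assume "\<not> w x < w y"
      hence gt: "w x > w y" using affine_sym_eq_iff[OF w, of x y] xy by linarith
      \<comment> \<open>Both values lie above \<open>y\<close>, and \<open>x < y\<close>, so some
        position right of \<open>y\<close> takes a value of at most \<open>y\<close>.\<close>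
      then obtain z where "z > y" "w z \<le> y"
        using affine_sym_crossing[OF n w, of x y] xy by auto
      thus False using no[of x y z] xy gt by auto
    qed
  next
    fix x y assume xy: "x \<in> {x. w x \<le> x}" "y \<in> {x. w x \<le> x}" "x < y"
    show "w x < w y"
    proof (rule ccontr)
      assume "\<not> w x < w y"
      hence gt: "w x > w y" using affine_sym_eq_iff[OF w, of x y] xy by linarith
      \<comment> \<open>Cutting below \<open>x\<close> also covers a fixed point \<open>x\<close>:
        the value found is at least \<open>x \<ge> w x\<close>, and injectivity makes it larger than
        \<open>w x\<close>.\<close>
      then obtain z where z: "z \<le> x - 1" "w z > x - 1"
        using affine_sym_crossing'[OF n w, of "x - 1" y] xy by auto
      moreover have "w z \<noteq> w x" using affine_sym_eq_iff[OF w] z(1) by auto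
      ultimately show False using no[of z x y] xy gt by auto
    qed
  qed
qed

section \<open>Length as total upward displacement\<close>

definition excess :: "nat \<Rightarrow> (int \<Rightarrow> int) \<Rightarrow> int" where
  "excess n w = (\<Sum>x = 1..int n. max 0 (w x - x))"

text \<open>At a descent of an avoider \<open>w i > i \<ge> w (i + 1)\<close>. Of these two values
  only \<open>w i\<close> contributes before and after the swap, and the swap brings its position
  one step closer.\<close>

lemma excess_descent:
  assumes n: "n \<ge> 2" and w: "w \<in> affine_sym n" and av: "avoids_321 w"
    and desc: "w (int i) > w (int i + 1)"
  shows "excess n w = excess n (w \<circ> simple_gen n i) + 1"
proof -
  let ?i = "int i"
  have n1: "n \<ge> 1" using n by simp
  have mono: "strict_mono_on {x. w x > x} w" "strict_mono_on {x. w x \<le> x} w"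
    using avoids_321_iff[OF n1 w] av by blast+
  have up: "w ?i > ?i"
    using strict_mono_onD[OF mono(2), of ?i "?i + 1"] desc by force
  have "w (?i + 1) \<le> ?i + 1"
    using strict_mono_onD[OF mono(1), of ?i "?i + 1"] desc up by force
  \<comment> \<open>A fixed point at \<open>i + 1\<close> would be the middle of a 321 pattern, as
    some later value has to compensate for \<open>w i\<close> crossing the cut.\<close>
  moreover have "w (?i + 1) \<noteq> ?i + 1"
  proof
    assume fixed: "w (?i + 1) = ?i + 1"
    then obtain z where z: "z > ?i + 1" "w z \<le> ?i + 1"
      using affine_sym_crossing[OF n1 w, of ?i "?i + 1"] desc by auto
    have "w z \<noteq> w (?i + 1)" using z affine_sym_eq_iff[OF w] by simp
    hence "\<exists>x y z. x < y \<and> y < z \<and> w x > w y \<and> w y > w z"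
      using z fixed desc by (intro exI[of _ ?i] exI[of _ "?i + 1"] exI[of _ z]) auto
    thus False using av unfolding avoids_321_def by blast
  qed
  ultimately have down: "w (?i + 1) \<le> ?i" by linarith
  have "excess n (w \<circ> simple_gen n i) = excess n w
      + max 0 (w (?i + 1) - ?i) + max 0 (w ?i - (?i + 1))
      - max 0 (w ?i - ?i) - max 0 (w (?i + 1) - (?i + 1))"
    unfolding excess_def comp_def
    by (rule sum_comp_simple_gen[of n "\<lambda>y x. max 0 (y - x)" w i])
      (simp_all add: n affine_symD(2)[OF w])
  thus ?thesis using up down by simp
qed

text \<open>Both sides vanish at the identity and drop by one at each descent.\<close>

lemma cox_length_eq_excess:
  assumes n: "n \<ge> 2" and w: "w \<in> affine_sym n" and av: "avoids_321 w"
  shows "int (cox_length n w) = excess n w"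
  using w av
proof (induction "cox_length n w" arbitrary: w rule: less_induct)
  case less
  note w = less.prems(1) and av = less.prems(2)
  show ?case
  proof (cases "w = id")
    case True
    thus ?thesis unfolding True cox_length_id by (simp add: excess_def)
  next
    case False
    have "n \<ge> 1" using n by simp
    then obtain i where i: "i < n" "w (int i) > w (int i + 1)"
      using affine_sym_descent[OF _ w False] by blast
    let ?v = "w \<circ> simple_gen n i"
    have len: "cox_length n w = Suc (cox_length n ?v)"
      by (rule cox_length_descent[OF n w i])
    have "int (cox_length n ?v) = excess n ?v"
      by (rule less.hyps) (use len affine_sym_comp_simple_gen[OF n w] avoids_321_descent[OF n w av i(2)] in auto)
    thus ?thesis using len excess_descent[OF n w av i(2)] by simp
  qed
qed

subsection \<open>Periodic increasing bijections\<close>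

text \<open>Numbering the lift of \<open>A\<close> by the integers turns periodic increasing maps
  into index shifts. Matching blocks of \<open>k\<close> indices with windows of length
  \<open>n\<close> later allows elements of different lifts to be compared.\<close>

lemma int_set_enumeration:
  fixes A :: "int set"
  assumes A: "A \<subseteq> {0..<int n}" and k: "card A = k" "k > 0"
  obtains e :: "int \<Rightarrow> int" where "strict_mono e" "range e = {x. x mod int n \<in> A}"
    "\<And>j. e (j + int k) = e j + int n" "e ` {0..<int k} = A" "\<And>j. e j div int n = j div int k"
proof -
  have fin: "finite A" using A finite_subset by blast
  define xs where "xs = sorted_list_of_set A"
  have xs: "sorted xs" "distinct xs" "set xs = A" "length xs = k"
    using fin k by (auto simp: xs_def)
  have n: "int n > 0" using A k by (cases "n = 0") auto
  \<comment> \<open>The quotient of the index by \<open>k\<close> selects the window, the remainder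
    the element of \<open>A\<close> inside it.\<close>
  define e where "e j = xs ! nat (j mod int k) + int n * (j div int k)" for j
  have in_A: "xs ! nat (j mod int k) \<in> A" for j
    using xs k nth_mem[of "nat (j mod int k)" xs] by (simp add: nat_less_iff)
  have range: "0 \<le> xs ! nat (j mod int k) \<and> xs ! nat (j mod int k) < int n" for j
    using in_A[of j] A by auto
  have div: "e j div int n = j div int k" and mod: "e j mod int n = xs ! nat (j mod int k)" for j
    using range[of j] n by (simp_all add: e_def)
  show ?thesis
  proof (rule that)
    show "strict_mono e"
    proof (rule strict_monoI)
      fix i j :: int assume ij: "i < j"
      hence "i div int k \<le> j div int k" using k by (simp add: zdiv_mono1)
      hence "i div int k < j div int k \<or> i div int k = j div int k" by linarith
      thus "e i < e j"
      proof
        assume "i div int k < j div int k"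
        hence "e i div int n < e j div int n" by (simp add: div)
        thus ?thesis using n by (meson not_less zdiv_mono1)
      next
        assume eq: "i div int k = j div int k"
        hence "i mod int k < j mod int k"
          using ij by (metis add_less_cancel_left mult_div_mod_eq)
        moreover have "0 \<le> i mod int k" "j mod int k < int k" using k by simp_all
        ultimately have "nat (i mod int k) < nat (j mod int k)" "nat (j mod int k) < length xs"
          using xs(4) by linarith+
        hence "xs ! nat (i mod int k) < xs ! nat (j mod int k)"
          using xs by (metis sorted_wrt_nth_less strict_sorted_iff)
        thus ?thesis by (simp add: e_def eq)
      qed
    qed
    have surj: "\<exists>j. 0 \<le> j \<and> j < int k \<and> xs ! nat j = a" if "a \<in> A" for a
      using that xs by (metis in_set_conv_nth nat_int of_nat_0_le_iff of_nat_less_iff)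
    show "e ` {0..<int k} = A"
    proof (intro equalityI subsetI)
      fix a assume "a \<in> A"
      then obtain j where "0 \<le> j" "j < int k" "xs ! nat j = a" using surj by blast
      thus "a \<in> e ` {0..<int k}" by (intro image_eqI[of _ _ j]) (auto simp: e_def)
    next
      fix a assume "a \<in> e ` {0..<int k}"
      then obtain j where "0 \<le> j" "j < int k" "a = e j" by auto
      thus "a \<in> A" using in_A[of j] by (simp add: e_def)
    qed
    show "range e = {x. x mod int n \<in> A}"
    proof (intro equalityI subsetI)
      fix x assume "x \<in> {x. x mod int n \<in> A}"
      then obtain j where "0 \<le> j" "j < int k" "xs ! nat j = x mod int n" using surj by blast
      hence "e (j + int k * (x div int n)) = x" using k by (simp add: e_def)
      thus "x \<in> range e" by (metis rangeI)
    qed (use in_A mod in auto)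
    show "e (j + int k) = e j + int n" for j
      using k by (simp add: e_def algebra_simps)
  qed (rule div)
qed

lemma sum_quasiperiodic_window:
  fixes f :: "int \<Rightarrow> int"
  assumes k: "k > 0" and f: "\<And>j. f (j + int k) = f j + d"
  shows "(\<Sum>j=r..<r + int k. f j) = (\<Sum>j=0..<int k. f j) + r * d"
proof -
  have step: "(\<Sum>j=a + 1..<a + 1 + int k. f j) = (\<Sum>j=a..<a + int k. f j) + d" for a
  proof -
    have "{a..<a + int k} = insert a {a + 1..<a + int k}"
      "{a + 1..<a + 1 + int k} = insert (a + int k) {a + 1..<a + int k}"
      using k by auto
    thus ?thesis using f by simp
  qed
  show ?thesis
  proof (induction r rule: int_induct[where k = 0])
    case (step1 i)
    thus ?case using step[of i] by (simp add: algebra_simps)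
  next
    case (step2 i)
    thus ?case using step[of "i - 1"] by (simp add: algebra_simps)
  qed simp
qed

text \<open>The increasing bijection moving the \<open>j\<close>-th element of the lift of \<open>A\<close> to the \<open>(j + r)\<close>-th
  element of the lift of \<open>B\<close>.\<close>

lemma periodic_increasing_bij:
  fixes A B :: "int set"
  assumes A: "A \<subseteq> {0..<int n}" "card A = k" and B: "B \<subseteq> {0..<int n}" "card B = k" and k: "k > 0"
  obtains g :: "int \<Rightarrow> int" where "strict_mono_on {x. x mod int n \<in> A} g"
    "bij_betw g {x. x mod int n \<in> A} {x. x mod int n \<in> B}"
    "\<And>x. x mod int n \<in> A \<Longrightarrow> g (x + int n) = g x + int n"
    "(\<Sum>x\<in>A. g x) = \<Sum>B + r * int n"
    "\<And>x. x mod int n \<in> A \<Longrightarrow> r \<ge> int n \<Longrightarrow> g x > x"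
    "\<And>x. x mod int n \<in> A \<Longrightarrow> r \<le> - int n \<Longrightarrow> g x < x"
proof -
  obtain e where e: "strict_mono e" "range e = {x. x mod int n \<in> A}"
    "\<And>j. e (j + int k) = e j + int n" "e ` {0..<int k} = A" "\<And>j. e j div int n = j div int k"
    using int_set_enumeration[OF A k] by blast
  obtain f where f: "strict_mono f" "range f = {x. x mod int n \<in> B}"
    "\<And>j. f (j + int k) = f j + int n" "f ` {0..<int k} = B" "\<And>j. f j div int n = j div int k"
    using int_set_enumeration[OF B k] by blast
  have inj: "inj e" "inj f" using e f by (auto simp: strict_mono_imp_inj_on)
  have n: "int n > 0" using A k by (cases "n = 0") auto
  have kn: "int k \<le> int n" using A card_mono[of "{0..<int n}" A] by simp
  define g where "g x = f (inv e x + r)" for x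
  have ge: "g (e j) = f (j + r)" for j using inj by (simp add: g_def)
  have obt: "\<exists>j. x = e j" if "x mod int n \<in> A" for x using that e(2) by blast
  show ?thesis
  proof (rule that)
    show "strict_mono_on {x. x mod int n \<in> A} g"
      unfolding e(2)[symmetric] using e(1) f(1)
      by (auto simp: strict_mono_on_def ge strict_mono_less)
    show "bij_betw g {x. x mod int n \<in> A} {x. x mod int n \<in> B}"
    proof -
      have "g ` range e = range (\<lambda>j. f (j + r))" by (simp add: ge image_image)
      also have "\<dots> = f ` range (\<lambda>j. j + r)" by (simp only: image_image)
      also have "range (\<lambda>j. j + r) = UNIV" by (rule surjI[of _ "\<lambda>j. j - r"]) simp
      finally have "g ` range e = range f" .
      moreover have "inj_on g (range e)"
        using inj by (auto intro!: inj_onI simp: ge inj_eq)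
      ultimately show ?thesis unfolding bij_betw_def e(2) f(2) by simp
    qed
    show "g (x + int n) = g x + int n" if x: "x mod int n \<in> A" for x
    proof -
      obtain j where j: "x = e j" using obt[OF x] by blast
      have "g (e (j + int k)) = f (j + r) + int n"
        using f(3)[of "j + r"] by (simp add: ge algebra_simps)
      thus ?thesis by (simp add: j ge e(3))
    qed
    show "(\<Sum>x\<in>A. g x) = \<Sum>B + r * int n"
    proof -
      have "(\<Sum>x\<in>A. g x) = (\<Sum>j=0..<int k. f (j + r))"
        unfolding e(4)[symmetric] using inj
        by (subst sum.reindex) (auto simp: ge inj_eq intro!: inj_onI)
      also have "\<dots> = (\<Sum>j=r..<r + int k. f j)"
        by (rule sum.reindex_bij_witness[of _ "\<lambda>j. j - r" "\<lambda>j. j + r"]) auto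
      also have "\<dots> = (\<Sum>j=0..<int k. f j) + r * int n"
        by (rule sum_quasiperiodic_window) (use k f(3) in auto)
      also have "(\<Sum>j=0..<int k. f j) = \<Sum>B"
        unfolding f(4)[symmetric] using inj by (subst sum.reindex) (auto simp: inj_eq intro!: inj_onI)
      finally show ?thesis .
    qed
    show "g x > x" if x: "x mod int n \<in> A" and r: "r \<ge> int n" for x
    proof -
      obtain j where j: "x = e j" using obt[OF x] by blast
      \<comment> \<open>As \<open>k \<le> n \<le> r\<close>, the index advances by at least one full
        block, so the value lies in a later window than \<open>x\<close>.\<close>
      have "j div int k < (j + int k) div int k" using k by simp
      also have "\<dots> \<le> (j + r) div int k" using r kn k by (intro zdiv_mono1) auto
      finally have "x div int n < g x div int n" by (simp add: j ge e f)
      thus ?thesis using n by (meson not_less zdiv_mono1)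
    qed
    show "g x < x" if x: "x mod int n \<in> A" and r: "r \<le> - int n" for x
    proof -
      obtain j where j: "x = e j" using obt[OF x] by blast
      have "(j + r) div int k \<le> (j - int k) div int k" using r kn k by (intro zdiv_mono1) auto
      also have "\<dots> < (j - int k + int k) div int k" using k by (simp only: div_add_self2)
      also have "\<dots> = j div int k" by simp
      finally have "x div int n > g x div int n" by (simp add: j ge e f)
      thus ?thesis using n by (meson not_less zdiv_mono1)
    qed
  qed
qed

text \<open>Two such maps differ by a shift of the index in their common image, so the one that is
  ahead at one point is ahead everywhere.\<close>

lemma increasing_same_image_less:
  fixes w w' :: "int \<Rightarrow> int"
  assumes mono: "strict_mono_on S w" "strict_mono_on S w'" and img: "w ` S = w' ` S"
    and per: "\<And>x. x + int n \<in> S \<longleftrightarrow> x \<in> S" "\<And>x. x \<in> S \<Longrightarrow> w (x + int n) = w x + int n"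
      "\<And>x. x \<in> S \<Longrightarrow> w' (x + int n) = w' x + int n"
    and n: "n \<ge> 1" and a: "a \<in> S" "w a < w' a" and b: "b \<in> S"
  shows "w b < w' b"
proof -
  have shift: "b + int k * int n \<in> S \<and> w (b + int k * int n) = w b + int k * int n
      \<and> w' (b + int k * int n) = w' b + int k * int n" for k
  proof (induction k)
    case (Suc k)
    thus ?case using per(1)[of "b + int k * int n"] per(2,3)[of "b + int k * int n"]
      by (simp add: algebra_simps)
  qed (simp add: b)
  \<comment> \<open>\<open>c\<close> is a translate of \<open>b\<close> to the right of
    \<open>a\<close>; by periodicity the claim at \<open>c\<close> gives the claim at
    \<open>b\<close>.\<close>
  define k where "k = nat (a - b) + 1"
  define c where "c = b + int k * int n"
  have "int k \<le> int k * int n" using n unfolding of_nat_mult[symmetric] of_nat_le_iff by simp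
  moreover have "a - b < int k" by (simp add: k_def)
  ultimately have c: "c \<in> S" "a < c" using shift[of k] unfolding c_def by (blast, linarith)
  let ?K = "{x \<in> S. a < x \<and> x \<le> c}"
  have fin: "finite ?K" by (rule finite_subset[of _ "{a..c}"]) auto
  have less: "w x < w y \<longleftrightarrow> x < y" "w' x < w' y \<longleftrightarrow> x < y" if "x \<in> S" "y \<in> S" for x y
    using that mono by (metis linorder_neq_iff order_less_asym strict_mono_onD)+
  have "w c < w' c"
  proof (rule ccontr)
    assume "\<not> ?thesis"
    hence le: "w' c \<le> w c" by simp
    \<comment> \<open>If \<open>w' c \<le> w c\<close>, the values of \<open>w'\<close> between
      \<open>a\<close> and \<open>c\<close> are also values of \<open>w\<close> there, and
      \<open>w' a\<close> is a further one; this contradicts equal cardinalities.\<close>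
    have "w' ` ?K \<subset> w ` ?K"
    proof
      show "w' ` ?K \<subseteq> w ` ?K"
      proof
        fix y assume "y \<in> w' ` ?K"
        then obtain x where x: "x \<in> S" "a < x" "x \<le> c" "y = w' x" by auto
        then obtain u where u: "u \<in> S" "w u = y" using img by (metis imageE imageI)
        have "w a < w u" using a x u less(2)[of a x] by auto
        moreover have "w u \<le> w c" using x u c le less(2)[of c x] by auto
        ultimately have "a < u" "u \<le> c" using less(1) u a c by (auto simp flip: not_less)
        thus "y \<in> w ` ?K" using u by auto
      qed
      obtain u where u: "u \<in> S" "w u = w' a" using img a by (metis imageE imageI)
      have "w' a < w' c" using less a c by blast
      hence "w a < w u" "w u < w c" using u a le by auto
      hence "u \<in> ?K" using less(1)[of a u] less(1)[of u c] u a c by auto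
      hence "w' a \<in> w ` ?K" using u by (metis imageI)
      moreover have "w' a \<notin> w' ` ?K"
      proof
        assume "w' a \<in> w' ` ?K"
        then obtain x where "x \<in> S" "a < x" "w' x = w' a" by auto
        thus False using less(2)[of a x] a by simp
      qed
      ultimately show "w' ` ?K \<noteq> w ` ?K" by blast
    qed
    hence "card (w' ` ?K) < card (w ` ?K)" using fin by (intro psubset_card_mono) auto
    moreover have "inj_on w ?K" "inj_on w' ?K"
      by (rule inj_on_subset[OF strict_mono_on_imp_inj_on], rule mono, blast)+
    ultimately show False by (simp add: card_image)
  qed
  thus ?thesis using shift[of k] by (simp add: c_def)
qed

subsection \<open>Counting excedance patterns\<close>

text \<open>A strict inequality at one point would spread to all of \<open>A\<close> and make the
  sums differ.\<close>

lemma increasing_same_image_eq: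
  fixes w w' :: "int \<Rightarrow> int"
  assumes n: "n \<ge> 1" and A: "A \<subseteq> {0..<int n}" and S: "S = {x. x mod int n \<in> A}"
    and mono: "strict_mono_on S w" "strict_mono_on S w'" and img: "w ` S = w' ` S"
    and per: "\<And>x. x \<in> S \<Longrightarrow> w (x + int n) = w x + int n"
      "\<And>x. x \<in> S \<Longrightarrow> w' (x + int n) = w' x + int n"
    and sum: "(\<Sum>x\<in>A. w x) = (\<Sum>x\<in>A. w' x)" and a: "a \<in> S"
  shows "w a = w' a"
proof (rule ccontr)
  assume ne: "w a \<noteq> w' a"
  have fin: "finite A" using A finite_subset by blast
  have AS: "A \<subseteq> S" using A by (auto simp: S)
  have nonempty: "A \<noteq> {}" using a by (auto simp: S)
  have S': "x + int n \<in> S \<longleftrightarrow> x \<in> S" for x by (simp add: S)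
  from ne consider "w a < w' a" | "w' a < w a" by linarith
  thus False
  proof cases
    case 1
    have "(\<Sum>x\<in>A. w x) < (\<Sum>x\<in>A. w' x)"
      using increasing_same_image_less[OF mono img S' per n a 1] AS
      by (intro sum_strict_mono fin nonempty) blast
    thus False using sum by simp
  next
    case 2
    have "(\<Sum>x\<in>A. w' x) < (\<Sum>x\<in>A. w x)"
      using increasing_same_image_less[OF mono(2,1) img[symmetric] S' per(2,1) n a 2] AS
      by (intro sum_strict_mono fin nonempty) blast
    thus False using sum by simp
  qed
qed

section \<open>Excedance positions and values as pairs of residue sets\<close>

definition excedances :: "nat \<Rightarrow> (int \<Rightarrow> int) \<Rightarrow> int set" where
  "excedances n w = {x \<in> {0..<int n}. w x > x}"

definition excedance_values :: "nat \<Rightarrow> (int \<Rightarrow> int) \<Rightarrow> int set" where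
  "excedance_values n w = (\<lambda>x. w x mod int n) ` excedances n w"

lemma excedances_subset: "excedances n w \<subseteq> {0..<int n}"
  by (auto simp: excedances_def)

lemma excedance_values_subset: "n \<ge> 1 \<Longrightarrow> excedance_values n w \<subseteq> {0..<int n}"
  by (auto simp: excedance_values_def)

lemma sum_affine_sym_window:
  assumes "w \<in> affine_sym n"
  shows "(\<Sum>x\<in>{0..<int n}. w x) = \<Sum>{0..<int n}"
proof -
  have "(\<Sum>x\<in>{0..<0 + int n}. w x - x) = (\<Sum>x = 1..int n. w x - x)"
    by (rule sum_periodic_window) (simp add: affine_symD[OF assms])
  thus ?thesis using affine_symD(3)[OF assms] by (simp add: sum_subtractf)
qed

lemma mod_in_excedances:
  assumes n: "n \<ge> 1" and w: "w \<in> affine_sym n"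
  shows "x mod int n \<in> excedances n w \<longleftrightarrow> w x > x"
proof -
  have "w x = w (x mod int n) + (x div int n) * int n"
    using affine_sym_shift[OF w, of "x mod int n" "x div int n"] by simp
  moreover have "x = x mod int n + (x div int n) * int n" by simp
  ultimately have "w x > x \<longleftrightarrow> w (x mod int n) > x mod int n" by linarith
  thus ?thesis using n by (simp add: excedances_def)
qed

lemma excess_eq_sum_excedances:
  assumes w: "w \<in> affine_sym n"
  shows "excess n w = (\<Sum>x\<in>excedances n w. w x) - \<Sum>(excedances n w)"
proof -
  have "excess n w = (\<Sum>x\<in>{0..<0 + int n}. max 0 (w x - x))"
    unfolding excess_def by (rule sum_periodic_window[symmetric]) (simp add: affine_symD[OF w])
  also have "\<dots> = (\<Sum>x\<in>excedances n w. max 0 (w x - x))"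
    by (rule sum.mono_neutral_right) (auto simp: excedances_def)
  also have "\<dots> = (\<Sum>x\<in>excedances n w. w x - x)"
    by (rule sum.cong) (auto simp: excedances_def)
  finally show ?thesis by (simp add: sum_subtractf)
qed

lemma inj_on_excedance_values:
  assumes w: "w \<in> affine_sym n"
  shows "inj_on (\<lambda>x. w x mod int n) (excedances n w)"
proof (rule inj_onI)
  fix x y assume xy: "x \<in> excedances n w" "y \<in> excedances n w" "w x mod int n = w y mod int n"
  then obtain k where "w x = w y + k * int n"
    by (metis add.commute diff_add_cancel dvd_div_mult_self mod_eq_dvd_iff)
  hence "w x = w (y + k * int n)" by (simp add: affine_sym_shift[OF w])
  hence "x = y + k * int n" using affine_sym_eq_iff[OF w] by blast
  hence "x mod int n = y mod int n" by simp
  thus "x = y" using xy by (simp add: excedances_def)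
qed

lemma image_excedances:
  assumes n: "n \<ge> 1" and w: "w \<in> affine_sym n"
  shows "w ` {x. w x > x} = {y. y mod int n \<in> excedance_values n w}"
proof (intro equalityI subsetI)
  fix y assume "y \<in> w ` {x. w x > x}"
  then obtain x where x: "w x > x" "y = w x" by blast
  have "w x = w (x mod int n) + (x div int n) * int n"
    using affine_sym_shift[OF w, of "x mod int n" "x div int n"] by simp
  hence "y mod int n = w (x mod int n) mod int n" by (simp add: x)
  thus "y \<in> {y. y mod int n \<in> excedance_values n w}"
    using x mod_in_excedances[OF n w, of x] by (auto simp: excedance_values_def)
next
  fix y assume "y \<in> {y. y mod int n \<in> excedance_values n w}"
  then obtain a where a: "w a > a" "y mod int n = w a mod int n"
    by (auto simp: excedance_values_def excedances_def)
  then obtain k where k: "y = w a + k * int n"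
    by (metis add.commute diff_add_cancel dvd_div_mult_self mod_eq_dvd_iff)
  have "y = w (a + k * int n)" by (simp add: k affine_sym_shift[OF w])
  moreover have "w (a + k * int n) > a + k * int n" using a by (simp add: affine_sym_shift[OF w])
  ultimately show "y \<in> w ` {x. w x > x}" by blast
qed

text \<open>Sizes \<open>0\<close> and \<open>n\<close> are left out: an empty \<open>A\<close>
  means excess zero, and so does a full one, since displacements over a window sum to zero.\<close>

definition window_pairs :: "nat \<Rightarrow> (int set \<times> int set) set" where
  "window_pairs n = {(A, B). A \<subseteq> {0..<int n} \<and> B \<subseteq> {0..<int n} \<and>
     card A = card B \<and> 0 < card A \<and> card A < n}"

text \<open>The excess is the sum of the values at \<open>A\<close> minus \<open>\<Sum>A\<close>,
  and those values are congruent to the elements of \<open>B\<close>.\<close>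

definition residue_pairs :: "nat \<Rightarrow> nat \<Rightarrow> (int set \<times> int set) set" where
  "residue_pairs n N = {(A, B) \<in> window_pairs n. int n dvd int N + \<Sum>A - \<Sum>B}"

definition avoiders_of_excess :: "nat \<Rightarrow> nat \<Rightarrow> (int \<Rightarrow> int) set" where
  "avoiders_of_excess n N = {w \<in> affine_sym n. avoids_321 w \<and> excess n w = int N}"

lemma excedance_pair_in_residue_pairs:
  assumes n: "n \<ge> 1" and N: "N > 0" and w: "w \<in> avoiders_of_excess n N"
  shows "(excedances n w, excedance_values n w) \<in> residue_pairs n N"
proof -
  let ?A = "excedances n w" and ?B = "excedance_values n w"
  have aff: "w \<in> affine_sym n" and ex: "excess n w = int N"
    using w by (auto simp: avoiders_of_excess_def)
  have fin: "finite ?A" by (rule finite_subset[OF excedances_subset]) simp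
  have card: "card ?B = card ?A"
    unfolding excedance_values_def by (rule card_image[OF inj_on_excedance_values[OF aff]])
  have ne: "?A \<noteq> {}" using ex N excess_eq_sum_excedances[OF aff] by auto
  have "?A \<noteq> {0..<int n}"
    using ex N excess_eq_sum_excedances[OF aff] sum_affine_sym_window[OF aff] by auto
  hence "?A \<subset> {0..<int n}" using excedances_subset by blast
  hence "card ?A < card {0..<int n}" by (intro psubset_card_mono) auto
  moreover have "int n dvd int N + \<Sum>?A - \<Sum>?B"
  proof -
    have "\<Sum>?B = (\<Sum>x\<in>?A. w x mod int n)"
      unfolding excedance_values_def
      by (simp add: sum.reindex[OF inj_on_excedance_values[OF aff]])
    hence "int N + \<Sum>?A - \<Sum>?B = (\<Sum>x\<in>?A. w x - w x mod int n)"
      using ex excess_eq_sum_excedances[OF aff] by (simp add: sum_subtractf)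
    moreover have "int n dvd (\<Sum>x\<in>?A. w x - w x mod int n)"
      by (intro dvd_sum) (simp add: minus_mod_eq_mult_div)
    ultimately show ?thesis by simp
  qed
  ultimately show ?thesis
    using card ne fin excedances_subset excedance_values_subset[OF n]
    by (auto simp: residue_pairs_def window_pairs_def card_gt_0_iff)
qed

text \<open>The pair fixes both classes of positions and both sets of values, so each restriction is
  determined by its sum; the excess fixes the first sum, the normalisation of the window sum the
  second.\<close>

lemma inj_on_excedance_pair:
  assumes n: "n \<ge> 1"
  shows "inj_on (\<lambda>w. (excedances n w, excedance_values n w)) (avoiders_of_excess n N)"
proof (rule inj_onI)
  fix w w' assume w: "w \<in> avoiders_of_excess n N" and w': "w' \<in> avoiders_of_excess n N"
    and eq: "(excedances n w, excedance_values n w) = (excedances n w', excedance_values n w')"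
  let ?A = "excedances n w" and ?S = "{x. w x > x}" and ?T = "{x. w x \<le> x}"
  let ?A' = "{0..<int n} - ?A"
  have aff: "w \<in> affine_sym n" "w' \<in> affine_sym n"
    and av: "avoids_321 w" "avoids_321 w'" and ex: "excess n w = excess n w'"
    using w w' by (auto simp: avoiders_of_excess_def)
  have S: "?S = {x. x mod int n \<in> ?A}" "{x. w' x > x} = ?S"
    using mod_in_excedances[OF n aff(1)] mod_in_excedances[OF n aff(2)] eq by auto
  have T: "{x. w' x \<le> x} = ?T" "?T = - ?S" using S(2) by (auto simp: set_eq_iff not_less[symmetric])
  have T': "?T = {x. x mod int n \<in> ?A'}"
    using n mod_in_excedances[OF n aff(1)] by (auto simp: not_less)
  have mono: "strict_mono_on ?S w" "strict_mono_on ?S w'" "strict_mono_on ?T w" "strict_mono_on ?T w'"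
    using av avoids_321_iff[OF n aff(1)] avoids_321_iff[OF n aff(2)] S(2) T(1) by auto
  have img: "w ` ?S = w' ` ?S"
    using image_excedances[OF n aff(1)] image_excedances[OF n aff(2)] eq S(2) by simp
  have "w ` ?T = - (w ` ?S)" "w' ` ?T = - (w' ` ?S)"
    unfolding T(2) using aff by (auto intro!: bij_image_Compl_eq affine_symD(1))
  hence img': "w ` ?T = w' ` ?T" using img by simp
  have sum: "(\<Sum>x\<in>?A. w x) = (\<Sum>x\<in>?A. w' x)"
    using ex excess_eq_sum_excedances[OF aff(1)] excess_eq_sum_excedances[OF aff(2)] eq by simp
  have sum': "(\<Sum>x\<in>?A'. w x) = (\<Sum>x\<in>?A'. w' x)"
    using sum sum_affine_sym_window[OF aff(1)] sum_affine_sym_window[OF aff(2)] excedances_subset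
    by (simp add: sum_diff)
  show "w = w'"
  proof
    fix x
    show "w x = w' x"
    proof (cases "x \<in> ?S")
      case True
      show ?thesis
        by (rule increasing_same_image_eq[OF n excedances_subset S(1) mono(1,2) img _ _ sum True])
          (auto intro: affine_symD(2)[OF aff(1)] affine_symD(2)[OF aff(2)])
    next
      case False
      hence x: "x \<in> ?T" by auto
      show ?thesis
        by (rule increasing_same_image_eq[OF n _ T' mono(3,4) img' _ _ sum' x])
          (auto intro: affine_symD(2)[OF aff(1)] affine_symD(2)[OF aff(2)])
    qed
  qed
qed

text \<open>Shift the lift of \<open>A\<close> up by \<open>r\<close> indices onto that of
  \<open>B\<close>, and the complementary lifts down by \<open>r\<close>, so that the displacements
  cancel; the excess dictates \<open>r\<close>.\<close>

lemma residue_pair_realized: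
  assumes n: "n \<ge> 1" and N: "N \<ge> 2 * n * n" and AB: "(A, B) \<in> residue_pairs n N"
  shows "\<exists>w \<in> avoiders_of_excess n N. excedances n w = A \<and> excedance_values n w = B"
proof -
  let ?W = "{0..<int n}" and ?l = "\<lambda>A. {x. x mod int n \<in> A}"
  have A: "A \<subseteq> ?W" and B: "B \<subseteq> ?W" and card: "card B = card A" and pos: "card A > 0"
    and less: "card A < n" and dvd: "int n dvd int N + \<Sum>A - \<Sum>B"
    using AB by (auto simp: residue_pairs_def window_pairs_def)
  have fin: "finite A" "finite B" using A B finite_subset by blast+
  obtain r where r: "int N + \<Sum>A - \<Sum>B = r * int n" using dvd by (auto simp: dvd_def mult.commute)
  \<comment> \<open>The bound on \<open>N\<close> enters here: \<open>\<Sum>B\<close> is at most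
    \<open>n * n\<close>, which leaves at least \<open>n * n\<close> for \<open>r * n\<close>. A
    shift by \<open>n\<close> or more indices moves every element strictly.\<close>
  have rn: "r \<ge> int n"
  proof -
    have "\<Sum>B \<le> (\<Sum>x\<in>B. int n)" using B by (intro sum_mono) auto
    also have "\<dots> \<le> int n * int n" using card less by (simp add: mult_right_mono)
    finally have "\<Sum>B \<le> int n * int n" .
    moreover have "\<Sum>A \<ge> 0" using A by (intro sum_nonneg) auto
    moreover have "int N \<ge> 2 * int n * int n"
      using N by (metis of_nat_le_iff of_nat_mult of_nat_numeral)
    ultimately have "r * int n \<ge> int n * int n" using r by linarith
    thus ?thesis using n by simp
  qed
  obtain g where g: "strict_mono_on (?l A) g" "bij_betw g (?l A) (?l B)"
    "\<And>x. x mod int n \<in> A \<Longrightarrow> g (x + int n) = g x + int n" "(\<Sum>x\<in>A. g x) = \<Sum>B + r * int n"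
    "\<And>x. x mod int n \<in> A \<Longrightarrow> r \<ge> int n \<Longrightarrow> g x > x"
    by (rule periodic_increasing_bij[OF A refl B card pos, of r]) (rule that)
  have cards: "card (?W - A) = n - card A" "card (?W - B) = n - card A" "n - card A > 0"
    using A B fin card less by (simp_all add: card_Diff_subset)
  obtain h where h: "strict_mono_on (?l (?W - A)) h" "bij_betw h (?l (?W - A)) (?l (?W - B))"
    "\<And>x. x mod int n \<in> ?W - A \<Longrightarrow> h (x + int n) = h x + int n"
    "(\<Sum>x\<in>?W - A. h x) = \<Sum>(?W - B) + (- r) * int n"
    "\<And>x. x mod int n \<in> ?W - A \<Longrightarrow> - r \<le> - int n \<Longrightarrow> h x < x"
    by (rule periodic_increasing_bij[OF Diff_subset cards(1) Diff_subset cards(2,3), of "- r"])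
      (rule that)
  have lA: "?l (?W - A) = - ?l A" and lB: "?l (?W - B) = - ?l B" using n by auto
  have mod: "x mod int n \<in> ?W - A \<longleftrightarrow> x mod int n \<notin> A" for x using n by auto
  define w where "w x = (if x mod int n \<in> A then g x else h x)" for x
  have gt: "w x > x \<longleftrightarrow> x mod int n \<in> A" for x
    using g(5)[of x] h(5)[of x] rn unfolding mod by (auto simp: w_def)
  have bij: "bij w"
  proof -
    have "bij_betw w (?l A) (?l B)" "bij_betw w (- ?l A) (- ?l B)"
      using g(2) h(2) bij_betw_cong[of "?l A" w g "?l B"] bij_betw_cong[of "- ?l A" w h "- ?l B"]
      unfolding lA lB by (simp_all add: w_def)
    from bij_betw_combine[OF this] show ?thesis by simp
  qed
  have per: "w (x + int n) = w x + int n" for x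
    using g(3)[of x] h(3)[of x] unfolding mod by (simp add: w_def)
  have amod: "x mod int n = x" if "x \<in> ?W" for x using that by simp
  have sumA: "(\<Sum>x\<in>A. w x) = \<Sum>B + r * int n"
    unfolding g(4)[symmetric] by (rule sum.cong) (use A amod in \<open>auto simp: w_def\<close>)
  have sumA': "(\<Sum>x\<in>?W - A. w x) = \<Sum>(?W - B) - r * int n"
  proof -
    have "(\<Sum>x\<in>?W - A. w x) = (\<Sum>x\<in>?W - A. h x)"
      by (rule sum.cong) (auto simp: w_def)
    thus ?thesis using h(4) by simp
  qed
  have aff: "w \<in> affine_sym n"
  proof -
    have "(\<Sum>x = 1..int n. w x - x) = (\<Sum>x\<in>{0..<0 + int n}. w x - x)"
      by (rule sum_periodic_window[symmetric]) (simp add: per)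
    also have "\<dots> = (\<Sum>x\<in>?W. w x) - \<Sum>?W" by (simp add: sum_subtractf)
    also have "(\<Sum>x\<in>?W. w x) = (\<Sum>x\<in>?W - A. w x) + (\<Sum>x\<in>A. w x)"
      by (rule sum.subset_diff) (use A in auto)
    also have "\<dots> = \<Sum>(?W - B) + \<Sum>B" using sumA sumA' by simp
    also have "\<dots> = \<Sum>?W" by (rule sum.subset_diff[symmetric]) (use B in auto)
    finally show ?thesis using bij per by (simp add: affine_sym_iff)
  qed
  have exA: "excedances n w = A" using A gt amod by (auto simp: excedances_def)
  have "excess n w = int N" using excess_eq_sum_excedances[OF aff] r by (simp add: exA sumA)
  moreover have "avoids_321 w"
  proof -
    have "{x. w x > x} = ?l A" "{x. w x \<le> x} = - ?l A" using gt by (auto simp: not_less[symmetric])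
    moreover have "strict_mono_on (?l A) w" "strict_mono_on (- ?l A) w"
      using g(1) h(1) unfolding lA by (auto simp: strict_mono_on_def w_def)
    ultimately show ?thesis using avoids_321_iff[OF n aff] by simp
  qed
  moreover have "excedance_values n w = B"
  proof (rule card_subset_eq[OF fin(2)])
    show "card (excedance_values n w) = card B"
      using card card_image[OF inj_on_excedance_values[OF aff]]
      by (simp add: excedance_values_def exA)
    have "g x mod int n \<in> B" if "x \<in> A" for x
      using bij_betwE[OF g(2)] that A amod by auto
    thus "excedance_values n w \<subseteq> B"
      using A amod by (auto simp: excedance_values_def exA w_def)
  qed
  ultimately show ?thesis using aff exA by (auto simp: avoiders_of_excess_def)
qed

lemma card_fc_of_length:
  assumes n: "n \<ge> 2" and N: "N \<ge> 2 * n * n"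
  shows "card (fc_of_length n N) = card (residue_pairs n N)"
proof -
  have n1: "n \<ge> 1" using n by simp
  have "N > 0" using n N by (metis gr0I le_zero_eq mult_eq_0_iff not_numeral_le_zero zero_neq_numeral)
  have "fc_of_length n N = avoiders_of_excess n N"
    by (auto simp: fc_of_length_def avoiders_of_excess_def fully_commutative_iff[OF n]
        simp flip: cox_length_eq_excess[OF n])
  moreover have "bij_betw (\<lambda>w. (excedances n w, excedance_values n w))
      (avoiders_of_excess n N) (residue_pairs n N)"
    unfolding bij_betw_def
  proof (intro conjI inj_on_excedance_pair[OF n1] equalityI subsetI)
    fix p assume "p \<in> residue_pairs n N"
    then obtain w where "w \<in> avoiders_of_excess n N" "p = (excedances n w, excedance_values n w)"
      using residue_pair_realized[OF n1 N, of "fst p" "snd p"] by (metis prod.collapse)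
    thus "p \<in> (\<lambda>w. (excedances n w, excedance_values n w)) ` avoiders_of_excess n N" by blast
  qed (use excedance_pair_in_residue_pairs[OF n1 \<open>N > 0\<close>] in auto)
  ultimately show ?thesis by (simp add: bij_betw_same_card)
qed

lemma residue_pairs_periodic: "residue_pairs n (N + n) = residue_pairs n N"
proof -
  have "int n dvd int (N + n) + a - b \<longleftrightarrow> int n dvd int N + a - b" for a b
    using dvd_add_right_iff[of "int n" "int n" "int N + a - b"] by (simp add: algebra_simps)
  thus ?thesis by (simp add: residue_pairs_def)
qed

section \<open>Rotations and equal distribution over residue classes for prime
  \<open>n\<close>\<close>

definition rotate_window :: "nat \<Rightarrow> int \<Rightarrow> int set \<Rightarrow> int set" where
  "rotate_window n j A = (\<lambda>x. (x + j) mod int n) ` A"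

lemma rotate_window_inverse:
  assumes "A \<subseteq> {0..<int n}"
  shows "rotate_window n (- j) (rotate_window n j A) = A"
proof -
  have "rotate_window n (- j) (rotate_window n j A) = (\<lambda>x. x mod int n) ` A"
    unfolding rotate_window_def image_image
    by (rule image_cong) (simp_all add: mod_diff_left_eq flip: diff_conv_add_uminus)
  also have "\<dots> = A" using assms by (force simp: image_iff)
  finally show ?thesis .
qed

lemma inj_on_rotate_window:
  assumes "A \<subseteq> {0..<int n}"
  shows "inj_on (\<lambda>x. (x + j) mod int n) A"
proof (rule inj_onI)
  fix x y assume xy: "x \<in> A" "y \<in> A" "(x + j) mod int n = (y + j) mod int n"
  hence "x mod int n = y mod int n" by (simp add: mod_eq_dvd_iff)
  thus "x = y" using xy assms by (metis atLeastLessThan_iff mod_pos_pos_trivial subsetD)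
qed

lemma rotate_window_subset: "n \<ge> 1 \<Longrightarrow> rotate_window n j A \<subseteq> {0..<int n}"
  by (auto simp: rotate_window_def)

lemma card_rotate_window: "A \<subseteq> {0..<int n} \<Longrightarrow> card (rotate_window n j A) = card A"
  unfolding rotate_window_def by (rule card_image[OF inj_on_rotate_window])

lemma sum_rotate_window:
  assumes "A \<subseteq> {0..<int n}"
  shows "int n dvd \<Sum>(rotate_window n j A) - (\<Sum>A + j * int (card A))"
proof -
  have "\<Sum>(rotate_window n j A) - (\<Sum>A + j * int (card A)) = (\<Sum>x\<in>A. (x + j) mod int n - (x + j))"
    unfolding rotate_window_def
    by (simp add: sum.reindex[OF inj_on_rotate_window[OF assms]] sum.distrib sum_subtractf)
  also have "int n dvd \<dots>"
    by (intro dvd_sum) (metis mod_eq_dvd_iff mod_mod_trivial)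
  finally show ?thesis .
qed

text \<open>Rotating \<open>A\<close> by the inverse of its size modulo \<open>n\<close> increases its sum by one.\<close>

lemma card_residue_pairs_prime_Suc:
  assumes p: "prime n"
  shows "card (residue_pairs n (Suc N)) = card (residue_pairs n N)"
proof -
  have n: "n \<ge> 1" using prime_gt_0_nat[OF p] by simp
  have "\<exists>m. int n dvd m * int k - 1" if "0 < k" "k < n" for k
  proof -
    have "\<not> n dvd k" using that by (auto dest: dvd_imp_le)
    hence "coprime n k" using prime_imp_coprime[OF p] by blast
    hence "gcd (int k) (int n) = 1" by (simp add: coprime_commute)
    then obtain u v where "u * int k + v * int n = 1" using bezout_int[of "int k" "int n"] by auto
    hence "u * int k - 1 = int n * (- v)" by (simp add: algebra_simps)
    thus ?thesis by (metis dvd_triv_left)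
  qed
  then obtain m where m: "\<And>k. 0 < k \<Longrightarrow> k < n \<Longrightarrow> int n dvd m k * int k - 1" by metis
  have key: "int n dvd int N + \<Sum>(rotate_window n (m (card A)) A) - \<Sum>B
      \<longleftrightarrow> int n dvd int (Suc N) + \<Sum>A - \<Sum>B" if "(A, B) \<in> window_pairs n" for A B
  proof -
    let ?R = "\<Sum>(rotate_window n (m (card A)) A)"
    have A: "A \<subseteq> {0..<int n}" and k: "0 < card A" "card A < n"
      using that by (auto simp: window_pairs_def)
    have "int n dvd (?R - (\<Sum>A + m (card A) * int (card A))) + (m (card A) * int (card A) - 1)"
      by (intro dvd_add sum_rotate_window[OF A] m[OF k])
    hence "int n dvd (int N + ?R - \<Sum>B) - (int (Suc N) + \<Sum>A - \<Sum>B)" by (simp add: algebra_simps)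
    thus ?thesis by (metis dvd_diff_commute dvd_diff_right_iff dvd_eq_mod_eq_0 mod_eq_dvd_iff)
  qed
  have rot: "(rotate_window n j A, B) \<in> window_pairs n" if "(A, B) \<in> window_pairs n" for A B j
    using that rotate_window_subset[OF n, of j A] card_rotate_window[of A n j]
    by (auto simp: window_pairs_def)
  have inv: "rotate_window n (- j) (rotate_window n j A) = A"
    "rotate_window n j (rotate_window n (- j) A) = A"
    "card (rotate_window n j A) = card A"
    if "(A, B) \<in> window_pairs n" for A B j
    using that rotate_window_inverse[of A n j] rotate_window_inverse[of A n "- j"]
      card_rotate_window[of A n j]
    by (auto simp: window_pairs_def)
  \<comment> \<open>Rotation preserves the size, so \<open>m (card A)\<close> is the same for a set
    and its rotation, and rotating back is the inverse map.\<close>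
  have "bij_betw (\<lambda>(A, B). (rotate_window n (m (card A)) A, B))
      (residue_pairs n (Suc N)) (residue_pairs n N)"
  proof (rule bij_betw_byWitness[where f' = "\<lambda>(A, B). (rotate_window n (- m (card A)) A, B)"])
    show "\<forall>p\<in>residue_pairs n (Suc N). (\<lambda>(A, B). (rotate_window n (- m (card A)) A, B))
        ((\<lambda>(A, B). (rotate_window n (m (card A)) A, B)) p) = p"
      using inv by (auto simp: residue_pairs_def)
    show "\<forall>p\<in>residue_pairs n N. (\<lambda>(A, B). (rotate_window n (m (card A)) A, B))
        ((\<lambda>(A, B). (rotate_window n (- m (card A)) A, B)) p) = p"
      using inv by (auto simp: residue_pairs_def)
    show "(\<lambda>(A, B). (rotate_window n (m (card A)) A, B)) ` residue_pairs n (Suc N) \<subseteq> residue_pairs n N"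
      using key rot by (auto simp: residue_pairs_def)
    show "(\<lambda>(A, B). (rotate_window n (- m (card A)) A, B)) ` residue_pairs n N \<subseteq> residue_pairs n (Suc N)"
    proof clarify
      fix A B assume AB: "(A, B) \<in> residue_pairs n N"
      hence w: "(A, B) \<in> window_pairs n" by (simp add: residue_pairs_def)
      show "(rotate_window n (- m (card A)) A, B) \<in> residue_pairs n (Suc N)"
        using key[OF rot[OF w, of "- m (card A)"]] inv[OF w] rot[OF w, of "- m (card A)"] AB
        by (simp add: residue_pairs_def)
    qed
  qed
  thus ?thesis by (rule bij_betw_same_card)
qed

text \<open>The sizes \<open>0\<close> and \<open>n\<close> contribute one pair each to the full sum
  of squared binomial coefficients.\<close>

lemma card_window_pairs:
  assumes n: "n \<ge> 1"
  shows "card (window_pairs n) + 2 = (2 * n) choose n"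
proof -
  let ?P = "\<lambda>k. {A. A \<subseteq> {0..<int n} \<and> card A = k}"
  have fin: "finite (?P k)" for k by simp
  have "window_pairs n = (\<Union>k\<in>{1..<n}. ?P k \<times> ?P k)"
    by (auto simp: window_pairs_def)
  also have "card \<dots> = (\<Sum>k\<in>{1..<n}. card (?P k \<times> ?P k))"
    by (rule card_UN_disjoint) (use fin in auto)
  also have "\<dots> = (\<Sum>k\<in>{1..<n}. (n choose k)\<^sup>2)"
    by (rule sum.cong) (simp_all add: card_cartesian_product n_subsets power2_eq_square)
  finally have "card (window_pairs n) = (\<Sum>k\<in>{1..<n}. (n choose k)\<^sup>2)" .
  moreover have "{..n} = insert 0 (insert n {1..<n})" using n by auto
  hence "(\<Sum>k\<le>n. (n choose k)\<^sup>2) = 2 + (\<Sum>k\<in>{1..<n}. (n choose k)\<^sup>2)"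
    using n by simp
  ultimately show ?thesis using choose_square_sum[of n] by simp
qed

lemma finite_window_pairs: "finite (window_pairs n)"
  by (rule finite_subset[of _ "Pow {0..<int n} \<times> Pow {0..<int n}"]) (auto simp: window_pairs_def)

text \<open>The classes for \<open>0, ..., n - 1\<close> partition all pairs and, by rotation, have
  equal size.\<close>

lemma card_residue_pairs_prime:
  assumes p: "prime n"
  shows "n * card (residue_pairs n N) + 2 = (2 * n) choose n"
proof -
  have n: "n \<ge> 1" using prime_gt_0_nat[OF p] by simp
  have const: "card (residue_pairs n N) = card (residue_pairs n 0)" for N
    by (induction N) (simp_all add: card_residue_pairs_prime_Suc[OF p])
  have "window_pairs n = (\<Union>c\<in>{..<n}. residue_pairs n c)"
  proof (intro equalityI subsetI)
    fix q assume "q \<in> window_pairs n"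
    then obtain A B where q: "q = (A, B)" "(A, B) \<in> window_pairs n" by (cases q) auto
    \<comment> \<open>The class of \<open>(A, B)\<close> is the residue solving the congruence for
      the excess.\<close>
    define c where "c = nat ((\<Sum>B - \<Sum>A) mod int n)"
    have "int c = (\<Sum>B - \<Sum>A) mod int n" using n by (simp add: c_def)
    moreover have "c < n" using n by (simp add: c_def nat_less_iff)
    moreover have "int n dvd (\<Sum>B - \<Sum>A) mod int n - (\<Sum>B - \<Sum>A)"
      by (metis mod_eq_dvd_iff mod_mod_trivial)
    ultimately have "c < n" "int n dvd int c + \<Sum>A - \<Sum>B" by (simp_all add: algebra_simps)
    thus "q \<in> (\<Union>c\<in>{..<n}. residue_pairs n c)"
      using q by (intro UN_I[of c]) (auto simp: residue_pairs_def)
  qed (auto simp: residue_pairs_def)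
  also have "card \<dots> = (\<Sum>c\<in>{..<n}. card (residue_pairs n c))"
  proof (rule card_UN_disjoint)
    show "\<forall>c\<in>{..<n}. finite (residue_pairs n c)"
      by (auto intro: finite_subset[OF _ finite_window_pairs] simp: residue_pairs_def)
    show "\<forall>c\<in>{..<n}. \<forall>d\<in>{..<n}. c \<noteq> d \<longrightarrow> residue_pairs n c \<inter> residue_pairs n d = {}"
    proof (intro ballI impI, rule ccontr)
      fix c d assume cd: "c \<in> {..<n}" "d \<in> {..<n}" "c \<noteq> d"
        and "residue_pairs n c \<inter> residue_pairs n d \<noteq> {}"
      then obtain A B where "int n dvd int c + \<Sum>A - \<Sum>B" "int n dvd int d + \<Sum>A - \<Sum>B"
        by (auto simp: residue_pairs_def)
      from dvd_diff[OF this] have "int c mod int n = int d mod int n"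
        by (simp add: mod_eq_dvd_iff)
      thus False using cd by simp
    qed
  qed simp
  also have "\<dots> = (\<Sum>c\<in>{..<n}. card (residue_pairs n N))"
    by (intro sum.cong refl) (metis const)
  finally show ?thesis using card_window_pairs[OF n] by simp
qed

text \<open>Without generators every reduced expression is empty.\<close>

lemma fc_of_length_1:
  assumes "i > 0"
  shows "fc_of_length 1 i = {}"
proof -
  have "cox_length 1 w = 0" if w: "w \<in> affine_sym 1" for w
  proof -
    obtain us where "us \<in> reduced_expressions 1 w" by (rule obtain_reduced[OF _ w]) simp_all
    thus ?thesis by (auto simp: reduced_expressions_def expressions_def gen_index_def)
  qed
  thus ?thesis using assms by (auto simp: fc_of_length_def fully_commutative_def)
qed

theorem corollary4p1:
  fixes n :: nat
  assumes "n \<ge> 1"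
  shows "(\<exists>m. m dvd n \<and>
            (\<exists>i0. \<forall>i\<ge>i0. fps_nth (fc_series n) (i + m) = fps_nth (fc_series n) i)) \<and>
         (prime n \<longrightarrow>
            (\<exists>i0. \<forall>i\<ge>i0. fps_nth (fc_series n) (i + 1) = fps_nth (fc_series n) i) \<and>
            (\<exists>i0. \<forall>i\<ge>i0. real (card (fc_of_length n i)) =
                 1 / real n * (real ((2 * n) choose n) - 2)))"
proof -
  have nth: "fps_nth (fc_series n) i = card (fc_of_length n i)" for i
    by (simp add: fc_series_def)
  show ?thesis
  proof (cases "n = 1")
    case True
    have zero: "card (fc_of_length n i) = 0" if "i > 0" for i
      using fc_of_length_1[OF that] True by simp
    have "\<forall>i\<ge>1. fps_nth (fc_series n) (i + 1) = fps_nth (fc_series n) i"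
      by (simp add: nth zero)
    thus ?thesis using True by (intro conjI exI[of _ 1] exI[of _ 1]) auto
  next
    case False
    hence n: "n \<ge> 2" using assms by simp
    \<comment> \<open>From \<open>2 * n * n\<close> on every pair is realized, so periods and counts
      can be read off the pairs.\<close>
    have card: "card (fc_of_length n i) = card (residue_pairs n i)" if "i \<ge> 2 * n * n" for i
      by (rule card_fc_of_length[OF n that])
    have period: "\<forall>i\<ge>2 * n * n. fps_nth (fc_series n) (i + n) = fps_nth (fc_series n) i"
      by (simp add: nth card residue_pairs_periodic)
    have period_1: "\<forall>i\<ge>2 * n * n. fps_nth (fc_series n) (i + 1) = fps_nth (fc_series n) i" if "prime n"
      by (simp add: nth card card_residue_pairs_prime_Suc[OF that])
    have count: "\<forall>i\<ge>2 * n * n. real (card (fc_of_length n i)) =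
        1 / real n * (real ((2 * n) choose n) - 2)" if "prime n"
    proof (intro allI impI)
      fix i assume "i \<ge> 2 * n * n"
      moreover have "real n * real (card (residue_pairs n i)) + 2 = real ((2 * n) choose n)"
        using card_residue_pairs_prime[OF that, of i] by (metis of_nat_add of_nat_mult of_nat_numeral)
      ultimately show "real (card (fc_of_length n i)) = 1 / real n * (real ((2 * n) choose n) - 2)"
        using n by (simp add: card field_simps)
    qed
    show ?thesis
    proof (intro conjI impI)
      show "\<exists>m. m dvd n \<and>
          (\<exists>i0. \<forall>i\<ge>i0. fps_nth (fc_series n) (i + m) = fps_nth (fc_series n) i)"
        using period by (intro exI[of _ n] conjI dvd_refl exI[of _ "2 * n * n"])
    qed (rule exI[of _ "2 * n * n"], erule period_1 count)+
  qed
qed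

end
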